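(* Let $t\geq 1$ be a fixed integer and let $\mathcal{G}$ be a class of $K_t$-free graphs (graphs with no clique on $t$ vertices) such that membership in $\mathcal{G}$ can be decided by an algorithm running in time $O(f(n))$ on $n$-vertex graphs, for some polynomial function $f$. Then \textsc{Subgraph Complement to} $\mathcal{G}$ can be solved in polynomial time, specifically in time $O(f(n)\cdot n^{8R(t,t)+4})$, where $n$ is the number of vertices of the input graph. In particular, \textsc{Subgraph Complement to} $K_t$-free graphs can be solved in time $O(n^{8R(t,t)+t+4})$.
   Context: All graphs are finite and simple. For a graph $G$ and $S\subseteq V(G)$, the subgraph complement $G\oplus S$ is the graph on $V(G)$ in which two distinct vertices $u,v$ are adjacent iff either ($uv\in E(G)$ and at least one of $u,v$ is not in $S$) or ($uv\notin E(G)$ and both $u,v\in S$); i.e., the subgraph induced by $S$ is complemented. For a class $\mathcal{G}$ of graphs, the problem \textsc{Subgraph Complement to} $\mathcal{G}$ asks: given a graph $G$, does there exist $S\subseteq V(G)$ with $G\oplus S\in\mathcal{G}$? For a graph $H$, "$H$-free" means having no induced subgraph isomorphic to $H$. $R(p,q)$ denotes the Ramsey number: the minimum integer $n$ such that every graph with at least $n$ vertices has a clique of size $p$ or an independent set of size $q$. *)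

theory Defs
  imports
    Complex_Main
    "HOL-Library.Ramsey"
    "HOL-Library.Landau_Symbols"
    "HOL-Computational_Algebra.Polynomial"
begin

section \<open>Graphs\<close>

type_synonym 'a graph = "'a set \<times> 'a set set"

definition simple_graph :: "'a graph \<Rightarrow> bool" where
  "simple_graph G \<longleftrightarrow> (case G of (V, E) \<Rightarrow> finite V \<and> E \<subseteq> nsets V 2)"

definition subgraph_complement :: "'a graph \<Rightarrow> 'a set \<Rightarrow> 'a graph" where
  "subgraph_complement G S = (case G of (V, E) \<Rightarrow>
     (V, {{u, v} | u v. u \<in> V \<and> v \<in> V \<and> u \<noteq> v \<and>
            (({u, v} \<in> E \<and> (u \<notin> S \<or> v \<notin> S)) \<or> ({u, v} \<notin> E \<and> u \<in> S \<and> v \<in> S))}))"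

definition complete_free :: "nat \<Rightarrow> 'a graph \<Rightarrow> bool" where
  "complete_free t G \<longleftrightarrow> (case G of (V, E) \<Rightarrow> \<not> (\<exists>K\<subseteq>V. card K = t \<and> clique K E))"

text \<open>Every finite graph has an isomorphic copy with natural numbers as vertices.\<close>

definition ramsey_number :: "nat \<Rightarrow> nat \<Rightarrow> nat" where
  "ramsey_number p q = (LEAST n. \<forall>(V :: nat set) E. simple_graph (V, E) \<and> n \<le> card V \<longrightarrow>
     (\<exists>K\<subseteq>V. card K = p \<and> clique K E) \<or> (\<exists>I\<subseteq>V. card I = q \<and> indep I E))"

definition subgraph_complement_to :: "'a graph set \<Rightarrow> 'a graph \<Rightarrow> bool" where
  "subgraph_complement_to \<G> G \<longleftrightarrow> (\<exists>S \<subseteq> fst G. subgraph_complement G S \<in> \<G>)"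

section \<open>Algorithms\<close>

text \<open>
  Algorithms are programs of a unit-cost random access machine over the natural numbers: a program
  uses finitely many registers and an unbounded memory with indirect addressing. The arithmetic
  operations are addition and truncated subtraction. Multiplication is deliberately absent: with
  unit-cost multiplication of unbounded numbers, polynomial time on such a machine would exceed
  ordinary polynomial time. Every instruction and every test of a register costs one time unit.
\<close>

type_synonym reg = nat

datatype prog =
    Skip
  | Const reg nat
  | Move reg reg
  | Add reg reg reg
  | Sub reg reg reg
  | Load reg reg      \<comment> \<open>\<open>Load r a\<close>: \<open>r := memory[a]\<close>\<close>
  | Store reg reg     \<comment> \<open>\<open>Store a r\<close>: \<open>memory[a] := r\<close>\<close>
  | Seq prog prog
  | IfNZ reg prog prog
  | WhileNZ reg prog

type_synonym state = "(reg \<Rightarrow> nat) \<times> (nat \<Rightarrow> nat)"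

text \<open>\<open>exec c s k s'\<close>: started in state \<open>s\<close>, program \<open>c\<close> halts in state \<open>s'\<close> after exactly \<open>k\<close> time
  units.\<close>

inductive exec :: "prog \<Rightarrow> state \<Rightarrow> nat \<Rightarrow> state \<Rightarrow> bool" where
  Skip: "exec Skip s 1 s"
| Const: "exec (Const r c) (R, M) 1 (R(r := c), M)"
| Move: "exec (Move r a) (R, M) 1 (R(r := R a), M)"
| Add: "exec (Add r a b) (R, M) 1 (R(r := R a + R b), M)"
| Sub: "exec (Sub r a b) (R, M) 1 (R(r := R a - R b), M)"
| Load: "exec (Load r a) (R, M) 1 (R(r := M (R a)), M)"
| Store: "exec (Store a r) (R, M) 1 (R, M(R a := R r))"
| Seq: "exec c\<^sub>1 s k\<^sub>1 s' \<Longrightarrow> exec c\<^sub>2 s' k\<^sub>2 s'' \<Longrightarrow> exec (Seq c\<^sub>1 c\<^sub>2) s (k\<^sub>1 + k\<^sub>2) s''"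
| IfTrue: "fst s r \<noteq> 0 \<Longrightarrow> exec c\<^sub>1 s k s' \<Longrightarrow> exec (IfNZ r c\<^sub>1 c\<^sub>2) s (1 + k) s'"
| IfFalse: "fst s r = 0 \<Longrightarrow> exec c\<^sub>2 s k s' \<Longrightarrow> exec (IfNZ r c\<^sub>1 c\<^sub>2) s (1 + k) s'"
| WhileFalse: "fst s r = 0 \<Longrightarrow> exec (WhileNZ r c) s 1 s"
| WhileTrue: "fst s r \<noteq> 0 \<Longrightarrow> exec c s k\<^sub>1 s' \<Longrightarrow> exec (WhileNZ r c) s' k\<^sub>2 s'' \<Longrightarrow>
    exec (WhileNZ r c) s (1 + k\<^sub>1 + k\<^sub>2) s''"

text \<open>The input graph has vertices \<open>0, \<dots>, n - 1\<close>: register \<open>0\<close> holds \<open>n\<close>, and the memory holds the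
  adjacency matrix in row-major order. Everything else is initially \<open>0\<close>.\<close>

definition input_state :: "nat \<Rightarrow> nat set set \<Rightarrow> state" where
  "input_state n E =
     ((\<lambda>r. if r = 0 then n else 0),
      (\<lambda>a. if \<exists>i<n. \<exists>j<n. a = i * n + j \<and> {i, j} \<in> E then 1 else 0))"

text \<open>The answer is left in register \<open>0\<close>.\<close>

definition decides_within :: "prog \<Rightarrow> (nat graph \<Rightarrow> bool) \<Rightarrow> (nat \<Rightarrow> nat) \<Rightarrow> bool" where
  "decides_within c P T \<longleftrightarrow> (\<forall>n E. simple_graph ({..<n}, E) \<longrightarrow>
     (\<exists>k s. exec c (input_state n E) k s \<and> k \<le> T n \<and>
            fst s 0 = (if P ({..<n}, E) then 1 else 0)))"

definition solvable_in_time :: "(nat graph \<Rightarrow> bool) \<Rightarrow> (nat \<Rightarrow> real) \<Rightarrow> bool" where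
  "solvable_in_time P g \<longleftrightarrow> (\<exists>c T. decides_within c P T \<and> (\<lambda>n. real (T n)) \<in> O(g))"

definition solvable_in_polynomial_time :: "(nat graph \<Rightarrow> bool) \<Rightarrow> bool" where
  "solvable_in_polynomial_time P \<longleftrightarrow> (\<exists>d. solvable_in_time P (\<lambda>n. real n ^ d))"

end

theory Submission
  imports Defs
begin

text \<open>
  If \<open>G \<oplus> S\<close> and \<open>G \<oplus> X\<close> are both \<open>K\<^sub>t\<close>-free, then a clique of \<open>G\<close> inside \<open>S - X\<close> survives in \<open>G \<oplus> X\<close> and an
  independent set inside \<open>S - X\<close> becomes a clique of \<open>G \<oplus> S\<close>; hence \<open>S - X\<close> has fewer than \<open>R(t, t)\<close> vertices,
  and \<open>S\<close> and \<open>X\<close> differ in fewer than \<open>2 R(t, t)\<close> vertices. So once a single \<open>S\<close> making \<open>G \<oplus> S\<close> \<open>K\<^sub>t\<close>-free is known,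
  it suffices to run the given decision algorithm on the sets that arise from \<open>S\<close> by few flips. Such
  an \<open>S\<close> is found by adding the vertices one at a time: \<open>K\<^sub>t\<close>-freeness is hereditary, so the restriction of a
  solution to the first \<open>i + 1\<close> vertices is again within \<open>2 R(t, t)\<close> flips of the set kept for the first
  \<open>i\<close> vertices. If no solution exists, the intermediate sets may be worthless, but then the final trials
  fail anyway.
\<close>

section \<open>Running times of programs\<close>

text \<open>The class need not be hereditary, so its own decision procedure cannot certify the sets
  kept along the way. An explicit clique checker does this, and the given program is called only for
  all n vertices. The checker costs about n^t per call, which has to vanish in a bound that mentions
  only f and R(t,t); this works because t <= R(t,t). With k = 2 R(t,t) flips, growing the set costs
  about n * n^k * n^(R(t,t) + 2) and the final stage n^k * (n^2 + f(n)), so the exponent 8 R(t,t) +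
  4 leaves ample room.

  The obstacle is the machine. The given program is a black box that expects its matrix at address 0
  and zeros elsewhere, and it may write to any address. Yet it must be called about n^k times
  without damaging the input and without a clean-up whose cost depends on the addresses used. Hence
  the programs called are translated to run in a virtual memory, with constant slowdown.\<close>

abbreviation Seq_infix :: "prog \<Rightarrow> prog \<Rightarrow> prog" (infixr ";;" 60) where
  "c ;; d \<equiv> Seq c d"

definition run :: "prog \<Rightarrow> state \<Rightarrow> nat \<Rightarrow> (state \<Rightarrow> bool) \<Rightarrow> bool" where
  "run c s T Q \<longleftrightarrow> (\<exists>k s'. exec c s k s' \<and> k \<le> T \<and> Q s')"

lemma run_mono:
  assumes "run c s T Q" "T \<le> T'" "\<And>s'. Q s' \<Longrightarrow> Q' s'"
  shows "run c s T' Q'"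
  using assms unfolding run_def by (meson le_trans)

lemma run_Seq:
  assumes "run c s T Q" "\<And>s'. Q s' \<Longrightarrow> run d s' T' Q'"
  shows "run (c ;; d) s (T + T') Q'"
  using assms unfolding run_def by (meson exec.Seq add_mono)

lemma run_IfNZ:
  assumes "fst s r \<noteq> 0 \<Longrightarrow> run c s T Q" "fst s r = 0 \<Longrightarrow> run d s T Q"
  shows "run (IfNZ r c d) s (1 + T) Q"
  using assms unfolding run_def by (meson exec.IfTrue exec.IfFalse add_le_cancel_left)

text \<open>All loops written below count a register down to 0, so the invariant is indexed by the
  value of the counter. Each round pays one test; the final failing test is the last
  \<open>+ 1\<close>.\<close>

lemma run_WhileNZ:
  assumes step: "\<And>m s. I (Suc m) s \<Longrightarrow> run c s T (I m)"
    and counter: "\<And>m s. I m s \<Longrightarrow> fst s r = m"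
    and init: "I m s"
  shows "run (WhileNZ r c) s (m * (T + 1) + 1) (I 0)"
  using init
proof (induction m arbitrary: s)
  case 0
  then show ?case
    using counter[OF 0] exec.WhileFalse[of s r c] unfolding run_def by fastforce
next
  case (Suc m)
  obtain k s' where 1: "exec c s k s'" "k \<le> T" "I m s'"
    using step[OF Suc.prems] unfolding run_def by blast
  obtain k' s'' where 2: "exec (WhileNZ r c) s' k' s''" "k' \<le> m * (T + 1) + 1" "I 0 s''"
    using Suc.IH[OF 1(3)] unfolding run_def by blast
  have "exec (WhileNZ r c) s (1 + k + k') s''"
    using exec.WhileTrue[OF _ 1(1) 2(1)] counter[OF Suc.prems] by simp
  moreover have "1 + k + k' \<le> Suc m * (T + 1) + 1"
    using 1(2) 2(2) by simp
  ultimately show ?case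
    using 2(3) unfolding run_def by blast
qed

text \<open>Loop-free code always halts, so its result and a time bound can be computed by
  rewriting. On loops, \<open>effect\<close> and \<open>cost\<close> take default values, and
  \<open>straight\<close> excludes them.\<close>

fun straight :: "prog \<Rightarrow> bool" where
  "straight (c ;; d) \<longleftrightarrow> straight c \<and> straight d"
| "straight (IfNZ r c d) \<longleftrightarrow> straight c \<and> straight d"
| "straight (WhileNZ r c) \<longleftrightarrow> False"
| "straight _ \<longleftrightarrow> True"

fun effect :: "prog \<Rightarrow> state \<Rightarrow> state" where
  "effect Skip s = s"
| "effect (Const r c) (R, M) = (R(r := c), M)"
| "effect (Move r a) (R, M) = (R(r := R a), M)"
| "effect (Add r a b) (R, M) = (R(r := R a + R b), M)"
| "effect (Sub r a b) (R, M) = (R(r := R a - R b), M)"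
| "effect (Load r a) (R, M) = (R(r := M (R a)), M)"
| "effect (Store a r) (R, M) = (R, M(R a := R r))"
| "effect (c ;; d) s = effect d (effect c s)"
| "effect (IfNZ r c d) s = (if fst s r \<noteq> 0 then effect c s else effect d s)"
| "effect (WhileNZ r c) s = s"

fun cost :: "prog \<Rightarrow> nat" where
  "cost (c ;; d) = cost c + cost d"
| "cost (IfNZ r c d) = 1 + max (cost c) (cost d)"
| "cost _ = 1"

lemma exec_straight: "straight c \<Longrightarrow> \<exists>k\<le>cost c. exec c s k (effect c s)"
proof (induction c s rule: effect.induct)
  case (8 c d s)
  then obtain k l where "k \<le> cost c" "exec c s k (effect c s)" "l \<le> cost d"
      "exec d (effect c s) l (effect d (effect c s))"
    by auto
  then show ?case
    using exec.Seq[of c s k "effect c s" d l] by (intro exI[of _ "k + l"]) auto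
next
  case (9 r c d s)
  show ?case
  proof (cases "fst s r = 0")
    case True
    then obtain k where "k \<le> cost d" "exec d s k (effect d s)"
      using 9 by auto
    then show ?thesis
      using exec.IfFalse[OF True, of d k _ c] True by (intro exI[of _ "1 + k"]) auto
  next
    case False
    then obtain k where "k \<le> cost c" "exec c s k (effect c s)"
      using 9 by auto
    then show ?thesis
      using exec.IfTrue[OF False, of c k _ d] False by (intro exI[of _ "1 + k"]) auto
  qed
next
  case (1 s)
  then show ?case
    using exec.Skip[of s] by (intro exI[of _ 1]) auto
next
  case (2 r c R M)
  then show ?case
    using exec.Const[of r c R M] by (intro exI[of _ 1]) auto
next
  case (3 r a R M)
  then show ?case
    using exec.Move[of r a R M] by (intro exI[of _ 1]) auto
next
  case (4 r a b R M)
  then show ?case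
    using exec.Add[of r a b R M] by (intro exI[of _ 1]) auto
next
  case (5 r a b R M)
  then show ?case
    using exec.Sub[of r a b R M] by (intro exI[of _ 1]) auto
next
  case (6 r a R M)
  then show ?case
    using exec.Load[of r a R M] by (intro exI[of _ 1]) auto
next
  case (7 a r R M)
  then show ?case
    using exec.Store[of a r R M] by (intro exI[of _ 1]) auto
qed simp

lemma run_straight: "straight c \<Longrightarrow> Q (effect c s) \<Longrightarrow> run c s (cost c) Q"
  using exec_straight unfolding run_def by blast

lemma run_straight_le: "straight c \<Longrightarrow> cost c \<le> T \<Longrightarrow> Q (effect c s) \<Longrightarrow> run c s T Q"
  by (rule run_mono[OF run_straight])

lemma run_straight_Seq:
  "straight c \<Longrightarrow> run d (effect c s) T Q \<Longrightarrow> run (c ;; d) s (cost c + T) Q"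
  by (rule run_Seq[OF run_straight[where Q = "\<lambda>s'. s' = effect c s"]]) auto

lemma run_Seq_straight:
  "run c s T (\<lambda>s'. Q (effect d s')) \<Longrightarrow> straight d \<Longrightarrow> run (c ;; d) s (T + cost d) Q"
  by (rule run_Seq[where Q = "\<lambda>s'. Q (effect d s')"]) (auto intro!: run_straight)

lemma exec_time_pos: "exec c s k s' \<Longrightarrow> k \<ge> 1"
  by (induction rule: exec.induct) auto

text \<open>Repeated addition, as the machine cannot multiply. The time is linear in the first
  factor \<open>a\<close>, which is why \<open>fill_row\<close> puts the row index there.\<close>

definition mul_prog :: "reg \<Rightarrow> reg \<Rightarrow> reg \<Rightarrow> reg \<Rightarrow> reg \<Rightarrow> prog" where
  "mul_prog one d a b i =
     Const d 0 ;; Move i a ;; WhileNZ i (Sub i i one ;; Add d d b)"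

lemma run_mul_prog:
  assumes "distinct [one, d, i]" "a \<notin> {d, i}" "b \<notin> {d, i}" "R one = 1"
    and Q: "Q (R(d := R a * R b, i := 0), M)"
  shows "run (mul_prog one d a b i) (R, M) (3 * R a + 3) Q"
proof -
  define I where "I m s \<longleftrightarrow> m \<le> R a \<and> s = (R(d := (R a - m) * R b, i := m), M)" for m s
  have "run (WhileNZ i (Sub i i one ;; Add d d b)) (R(d := 0, i := R a), M)
     (R a * (2 + 1) + 1) (I 0)"
  proof (rule run_WhileNZ)
    fix m s assume I: "I (Suc m) s"
    then have "R a - m = Suc (R a - Suc m)"
      unfolding I_def by auto
    then have eq: "(R a - Suc m) * R b + R b = (R a - m) * R b"
      by (metis add.commute mult_Suc)
    have "I m (effect (Sub i i one ;; Add d d b) s)"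
      using I eq assms(1-4) unfolding I_def by (auto simp: fun_eq_iff)
    then show "run (Sub i i one ;; Add d d b) s 2 (I m)"
      using run_straight[of "Sub i i one ;; Add d d b" "I m" s] by (simp add: numeral_2_eq_2)
  next
    show "fst s i = m" if "I m s" for m s
      using that unfolding I_def by auto
    show "I (R a) (R(d := 0, i := R a), M)"
      unfolding I_def by auto
  qed
  then have "run (Const d 0 ;; Move i a ;; WhileNZ i (Sub i i one ;; Add d d b)) (R, M)
      (cost (Const d 0) + (cost (Move i a) + (R a * (2 + 1) + 1))) (I 0)"
    using assms(2) by (intro run_straight_Seq) auto
  then show ?thesis
    unfolding mul_prog_def by (rule run_mono) (use Q in \<open>auto simp: I_def\<close>)
qed

section \<open>Sandboxed execution\<close>

fun regs_below :: "nat \<Rightarrow> prog \<Rightarrow> bool" where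
  "regs_below N Skip \<longleftrightarrow> True"
| "regs_below N (Const r c) \<longleftrightarrow> r < N"
| "regs_below N (Move r a) \<longleftrightarrow> r < N \<and> a < N"
| "regs_below N (Add r a b) \<longleftrightarrow> r < N \<and> a < N \<and> b < N"
| "regs_below N (Sub r a b) \<longleftrightarrow> r < N \<and> a < N \<and> b < N"
| "regs_below N (Load r a) \<longleftrightarrow> r < N \<and> a < N"
| "regs_below N (Store a r) \<longleftrightarrow> a < N \<and> r < N"
| "regs_below N (c ;; d) \<longleftrightarrow> regs_below N c \<and> regs_below N d"
| "regs_below N (IfNZ r c d) \<longleftrightarrow> r < N \<and> regs_below N c \<and> regs_below N d"
| "regs_below N (WhileNZ r c) \<longleftrightarrow> r < N \<and> regs_below N c"

lemma regs_below_mono: "regs_below N c \<Longrightarrow> N \<le> N' \<Longrightarrow> regs_below N' c"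
  by (induction c) auto

text \<open>\<open>N \<ge> 1\<close> keeps register 0, which carries both input and answer, inside
  the simulated register bank.\<close>

lemma ex_regs_below: "\<exists>N\<ge>1. regs_below N c"
proof (induction c)
  case (Const r c)
  show ?case by (intro exI[of _ "Suc r"]) auto
next
  case (Move r a)
  show ?case by (intro exI[of _ "Suc (r + a)"]) auto
next
  case (Add r a b)
  show ?case by (intro exI[of _ "Suc (r + a + b)"]) auto
next
  case (Sub r a b)
  show ?case by (intro exI[of _ "Suc (r + a + b)"]) auto
next
  case (Load r a)
  show ?case by (intro exI[of _ "Suc (r + a)"]) auto
next
  case (Store a r)
  show ?case by (intro exI[of _ "Suc (r + a)"]) auto
next
  case (Seq c d)
  then obtain N N' where "N \<ge> 1" "regs_below N c" "regs_below N' d" by blast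
  then show ?case
    by (intro exI[of _ "N + N'"]) (auto intro: regs_below_mono)
next
  case (IfNZ r c d)
  then obtain N N' where "N \<ge> 1" "regs_below N c" "regs_below N' d" by blast
  then show ?case
    by (intro exI[of _ "Suc (r + N + N')"]) (auto intro: regs_below_mono)
next
  case (WhileNZ r c)
  then obtain N where "N \<ge> 1" "regs_below N c" by blast
  then show ?case
    by (intro exI[of _ "Suc (r + N)"]) (auto intro: regs_below_mono)
qed auto

text \<open>Above the input matrix, which occupies the \<open>B = n\<^sup>2\<close> first cells, the memory is interleaved: track \<open>0\<close> is the memory
  of a sandboxed program, track \<open>1\<close> records for each of its cells the number of the call that wrote it
  last, and track \<open>2\<close> holds the characteristic function of the current vertex set.\<close>

definition addr :: "nat \<Rightarrow> nat \<Rightarrow> nat \<Rightarrow> nat" where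
  "addr B j a = B + 3 * a + j"

lemma addr_eq_iff: "i < 3 \<Longrightarrow> j < 3 \<Longrightarrow> addr B i a = addr B j b \<longleftrightarrow> i = j \<and> a = b"
  unfolding addr_def by presburger

lemma addr_simps [simp]:
  "addr B 0 a = addr B 0 b \<longleftrightarrow> a = b"
  "addr B 1 a = addr B 1 b \<longleftrightarrow> a = b"
  "addr B (Suc 0) a = addr B (Suc 0) b \<longleftrightarrow> a = b"
  "addr B 2 a = addr B 2 b \<longleftrightarrow> a = b"
  "addr B 0 a \<noteq> addr B 1 b" "addr B 1 a \<noteq> addr B 0 b"
  "addr B 0 a \<noteq> addr B (Suc 0) b" "addr B (Suc 0) a \<noteq> addr B 0 b"
  "addr B 0 a \<noteq> addr B 2 b" "addr B 2 a \<noteq> addr B 0 b"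
  "addr B 1 a \<noteq> addr B 2 b" "addr B 2 a \<noteq> addr B 1 b"
  "addr B (Suc 0) a \<noteq> addr B 2 b" "addr B 2 a \<noteq> addr B (Suc 0) b"
  by (simp_all add: addr_eq_iff)

lemma addr_outside [simp]: "x < B \<Longrightarrow> x \<noteq> addr B j a" "x < B \<Longrightarrow> addr B j a \<noteq> x"
  by (auto simp: addr_def)

lemma addr_compute [simp]:
  "a + a + a + B = addr B 0 a" "a + a + a + Suc B = addr B (Suc 0) a"
  "a + a + a + Suc (Suc B) = addr B 2 a"
  "Suc (addr B 0 a) = addr B (Suc 0) a" "Suc (addr B (Suc 0) a) = addr B 2 a"
  by (auto simp: addr_def)

text \<open>Registers: \<open>0\<close> to \<open>9\<close> scratch, \<open>10\<close> the number of the current sandbox call, \<open>11\<close> the answer of the last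
  trial, \<open>12\<close> the constant \<open>1\<close>, \<open>13\<close> the input size \<open>n\<close>, \<open>14\<close>, \<open>15\<close>, \<open>16\<close> the bases \<open>B\<close>, \<open>B + 1\<close>, \<open>B + 2\<close> of the three
  tracks, \<open>17\<close> the number \<open>i\<close> of vertices under consideration, \<open>18\<close> the counter of the outer loop, and
  \<open>20 + j\<close> the counter of the \<open>j\<close>-th nested search loop. Sandboxed programs use the registers from \<open>L\<close> on.\<close>

definition load_prog :: "reg \<Rightarrow> reg \<Rightarrow> prog" where
  "load_prog r a =
     Add 0 a a ;; Add 0 0 a ;; Add 1 0 15 ;; Load 1 1 ;; Sub 1 10 1 ;;
     IfNZ 1 (Const r 0) (Add 0 0 14 ;; Load r 0)"

definition store_prog :: "reg \<Rightarrow> reg \<Rightarrow> prog" where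
  "store_prog a r =
     Add 0 a a ;; Add 0 0 a ;; Add 1 0 15 ;; Store 1 10 ;; Add 0 0 14 ;; Store 0 r"

fun sandbox :: "nat \<Rightarrow> prog \<Rightarrow> prog" where
  "sandbox L Skip = Skip"
| "sandbox L (Const r c) = Const (L + r) c"
| "sandbox L (Move r a) = Move (L + r) (L + a)"
| "sandbox L (Add r a b) = Add (L + r) (L + a) (L + b)"
| "sandbox L (Sub r a b) = Sub (L + r) (L + a) (L + b)"
| "sandbox L (Load r a) = load_prog (L + r) (L + a)"
| "sandbox L (Store a r) = store_prog (L + a) (L + r)"
| "sandbox L (c ;; d) = sandbox L c ;; sandbox L d"
| "sandbox L (IfNZ r c d) = IfNZ (L + r) (sandbox L c) (sandbox L d)"
| "sandbox L (WhileNZ r c) = WhileNZ (L + r) (sandbox L c)"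

text \<open>A cell not written during the current call reads as \<open>0\<close>, so increasing register \<open>10\<close> erases the whole
  sandbox in one step, whatever addresses the previous call used.\<close>

definition virtual :: "nat \<Rightarrow> state \<Rightarrow> nat \<Rightarrow> nat" where
  "virtual B z a =
     (if snd z (addr B 1 a) = fst z 10 then snd z (addr B 0 a) else 0)"

lemma virtual_reg [simp]: "r \<noteq> 10 \<Longrightarrow> virtual B (R(r := x), M) = virtual B (R, M)"
  by (auto simp: virtual_def)

lemma virtual_store [simp]:
  "q = R 10 \<Longrightarrow> virtual B (R, M(addr B (Suc 0) a := q, addr B 0 a := x)) = (virtual B (R, M))(a := x)"
  by (auto simp: virtual_def)

text \<open>\<open>z0\<close> is the host state at the start of the call. Registers 0 and 1 are
  exempt from the frame because translated memory accesses compute addresses in them. Register 10 is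
  framed, so the call number is constant during a call.\<close>

definition simulates :: "nat \<Rightarrow> nat \<Rightarrow> nat \<Rightarrow> state \<Rightarrow> state \<Rightarrow> state \<Rightarrow> bool" where
  "simulates L N B z0 s z \<longleftrightarrow>
     (\<forall>r<N. fst z (L + r) = fst s r) \<and> virtual B z = snd s \<and>
     (\<forall>a. snd z (addr B 1 a) \<le> fst z 10) \<and>
     (\<forall>r. 2 \<le> r \<and> r < L \<longrightarrow> fst z r = fst z0 r) \<and>
     (\<forall>a<B. snd z a = snd z0 a) \<and> (\<forall>x. snd z (addr B 2 x) = snd z0 (addr B 2 x))"

text \<open>Induction on the execution rather than on the program carries termination and time
  through loops. The factor 8 is the cost of \<open>load_prog\<close>, the most expensive
  translation of an instruction.\<close>

lemma run_sandbox:
  assumes "exec c s k s'" "regs_below N c" "simulates L N B z0 s z"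
    and base: "L \<ge> 20" "fst z0 14 = B" "fst z0 15 = B + 1"
  shows "run (sandbox L c) z (8 * k) (simulates L N B z0 s')"
  using assms(1-3)
proof (induction arbitrary: z rule: exec.induct)
  case (Skip s)
  then show ?case
    by (auto intro!: run_straight_le)
next
  case (Const r c R M)
  obtain R' M' where z: "z = (R', M')" by force
  show ?case
    by (rule run_straight_le) (use Const base in \<open>auto simp: z simulates_def\<close>)
next
  case (Move r a R M)
  obtain R' M' where z: "z = (R', M')" by force
  show ?case
    by (rule run_straight_le) (use Move base in \<open>auto simp: z simulates_def\<close>)
next
  case (Add r a b R M)
  obtain R' M' where z: "z = (R', M')" by force
  show ?case
    by (rule run_straight_le) (use Add base in \<open>auto simp: z simulates_def\<close>)
next
  case (Sub r a b R M)
  obtain R' M' where z: "z = (R', M')" by force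
  show ?case
    by (rule run_straight_le) (use Sub base in \<open>auto simp: z simulates_def\<close>)
next
  case (Load r a R M)
  obtain R' M' where z: "z = (R', M')" by force
  \<comment> \<open>Stamps never exceed the call number, so the truncated difference computed by
    \<open>load_prog\<close> vanishes exactly when the two are equal.\<close>
  have regs: "R' 14 = B" "R' 15 = Suc B" "R' (L + a) = R a" "M (R a) = virtual B z (R a)"
      "M' (addr B (Suc 0) (R a)) \<le> R' 10"
    using Load base by (auto simp: z simulates_def)
  show ?case
    by (rule run_straight_le)
      (use Load base regs in \<open>auto simp: z load_prog_def simulates_def virtual_def\<close>)
next
  case (Store a r R M)
  obtain R' M' where z: "z = (R', M')" by force
  have regs: "R' 14 = B" "R' 15 = Suc B" "R' (L + a) = R a" "R' (L + r) = R r"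
    using Store base by (auto simp: z simulates_def)
  show ?case
    by (rule run_straight_le) (use Store base regs in \<open>auto simp: z store_prog_def simulates_def\<close>)
next
  case (Seq c1 s k1 s' c2 k2 s'')
  have "run (sandbox L c1 ;; sandbox L c2) z (8 * k1 + 8 * k2) (simulates L N B z0 s'')"
    by (rule run_Seq[OF Seq.IH(1) Seq.IH(2)]) (use Seq.prems in simp_all)
  then show ?case by (simp add: distrib_left)
next
  case (IfTrue s r c1 k s' c2)
  then have "run (IfNZ (L + r) (sandbox L c1) (sandbox L c2)) z (1 + 8 * k) (simulates L N B z0 s')"
    by (intro run_IfNZ IfTrue.IH) (auto simp: simulates_def)
  then show ?case
    unfolding sandbox.simps by (rule run_mono) simp_all
next
  case (IfFalse s r c2 k s' c1)
  then have "run (IfNZ (L + r) (sandbox L c1) (sandbox L c2)) z (1 + 8 * k) (simulates L N B z0 s')"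
    by (intro run_IfNZ IfFalse.IH) (auto simp: simulates_def)
  then show ?case
    unfolding sandbox.simps by (rule run_mono) simp_all
next
  case (WhileFalse s r c)
  then have "fst z (L + r) = 0"
    by (auto simp: simulates_def)
  from exec.WhileFalse[OF this] have "exec (sandbox L (WhileNZ r c)) z 1 z"
    by simp
  then show ?case
    unfolding run_def using WhileFalse.prems by (intro exI[of _ 1] exI[of _ z]) simp
next
  case (WhileTrue s r c k1 s' k2 s'')
  then have nz: "fst z (L + r) \<noteq> 0"
    by (auto simp: simulates_def)
  obtain l1 z' where 1: "exec (sandbox L c) z l1 z'" "l1 \<le> 8 * k1" "simulates L N B z0 s' z'"
    using WhileTrue.IH(1)[of z] WhileTrue.prems unfolding run_def by auto
  obtain l2 z'' where 2: "exec (sandbox L (WhileNZ r c)) z' l2 z''" "l2 \<le> 8 * k2"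
      "simulates L N B z0 s'' z''"
    using WhileTrue.IH(2)[of z'] WhileTrue.prems 1(3) unfolding run_def by auto
  have "exec (sandbox L (WhileNZ r c)) z (1 + l1 + l2) z''"
    using exec.WhileTrue[OF nz 1(1)] 2(1) by simp
  moreover have "1 + l1 + l2 \<le> 8 * (1 + k1 + k2)"
    using 1(2) 2(2) by simp
  ultimately show ?case
    using 2(3) unfolding run_def by blast
qed

section \<open>Trying one vertex set\<close>

text \<open>Arranged for assembling a program from its tail: the state after \<open>c\<close> is
  fixed by the fact about \<open>d\<close>, and the remaining goals are evaluations.\<close>

lemma run_straight_then:
  assumes "run d s' T' Q" "straight c" "effect c s = s'" "cost c + T' \<le> T"
  shows "run (c ;; d) s T Q"
  using run_mono[OF run_straight_Seq[OF assms(2), of d s T' Q]] assms(1,3,4) by auto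

lemma run_mul_then:
  assumes "run c s' T' Q" "distinct [one, d, i]" "a \<notin> {d, i}" "b \<notin> {d, i}" "R one = 1"
    and "s' = (R(d := R a * R b, i := 0), M)" "3 * R a + 3 + T' \<le> T"
  shows "run (mul_prog one d a b i ;; c) (R, M) T Q"
  by (rule run_mono[OF run_Seq[OF run_mul_prog[where Q = "\<lambda>s. s = s'"]]]) (use assms in auto)

text \<open>The vertex set is recorded up to and including index \<open>n\<close>, since the dummy
  flip on the full graph writes there.\<close>

definition layout :: "nat \<Rightarrow> nat set set \<Rightarrow> nat set \<Rightarrow> state \<Rightarrow> bool" where
  "layout n E S z \<longleftrightarrow>
     fst z 12 = 1 \<and> fst z 13 = n \<and> fst z 14 = n * n \<and> fst z 15 = n * n + 1 \<and> fst z 16 = n * n + 2 \<and>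
     (\<forall>u<n. \<forall>v<n. snd z (u * n + v) = of_bool ({u, v} \<in> E)) \<and>
     (\<forall>x\<le>n. snd z (addr (n * n) 2 x) = of_bool (x \<in> S)) \<and>
     (\<forall>a. snd z (addr (n * n) 1 a) \<le> fst z 10)"

text \<open>Registers 4 to 8 hold \<open>u\<close>, the column counter, \<open>u * n\<close>,
  \<open>u * i\<close> and the membership bit of \<open>u\<close>. The entry is inverted exactly if
  \<open>u\<close> and \<open>v\<close> are distinct members of the set; distinctness is tested by
  the sum of the two truncated differences.\<close>

definition fill_cell :: prog where
  "fill_cell =
     Sub 5 5 12 ;; Add 0 6 5 ;; Load 1 0 ;; Add 2 5 5 ;; Add 2 2 5 ;; Add 2 2 16 ;; Load 2 2 ;;
     IfNZ 8 (IfNZ 2 (Sub 3 4 5 ;; Sub 9 5 4 ;; Add 3 3 9 ;; IfNZ 3 (Sub 1 12 1) Skip) Skip) Skip ;;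
     Add 2 7 5 ;; Move 3 1 ;; store_prog 2 3"

definition fill_row :: prog where
  "fill_row =
     Sub 4 4 12 ;; mul_prog 12 6 4 13 9 ;; mul_prog 12 7 4 17 9 ;;
     (Add 8 4 4 ;; Add 8 8 4 ;; Add 8 8 16 ;; Load 8 8 ;; Move 5 17) ;; WhileNZ 5 fill_cell"

definition fill_matrix :: prog where
  "fill_matrix = Move 4 17 ;; WhileNZ 4 fill_row"

text \<open>Registers carry no stamps, so they are cleared one by one; their number depends only on
  the program.\<close>

fun zero_regs :: "nat \<Rightarrow> nat \<Rightarrow> prog" where
  "zero_regs L 0 = Skip"
| "zero_regs L (Suc N) = zero_regs L N ;; Const (L + N) 0"

lemma straight_zero_regs [simp]: "straight (zero_regs L N)"
  by (induction N) auto

lemma cost_zero_regs [simp]: "cost (zero_regs L N) = N + 1"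
  by (induction N) auto

lemma effect_zero_regs [simp]:
  "effect (zero_regs L N) (R, M) = (\<lambda>r. if L \<le> r \<and> r < L + N then 0 else R r, M)"
  by (induction N) (auto simp: fun_eq_iff)

definition trial :: "nat \<Rightarrow> nat \<Rightarrow> prog \<Rightarrow> prog" where
  "trial L N c =
     Add 10 10 12 ;; fill_matrix ;; (zero_regs L N ;; Move L 17) ;; sandbox L c ;; Move 11 L"

definition adj_matrix :: "nat \<Rightarrow> nat set set \<Rightarrow> nat \<Rightarrow> nat" where
  "adj_matrix i F a = (if \<exists>u<i. \<exists>v<i. a = u * i + v \<and> {u, v} \<in> F then 1 else 0)"

lemma index_less:
  fixes u v n :: nat
  assumes "u < n" "v < n"
  shows "u * n + v < n * n"
proof -
  have "u * n + v < Suc u * n" using assms by simp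
  also have "\<dots> \<le> n * n" using assms by (intro mult_right_mono) auto
  finally show ?thesis .
qed

lemma adj_matrix_entry:
  assumes "u < i" "v < i"
  shows "adj_matrix i F (u * i + v) = of_bool ({u, v} \<in> F)"
proof -
  have "u' = u \<and> v' = v" if "u * i + v = u' * i + v'" "v' < i" for u' v'
    using that assms by (metis add.commute div_mult_self1_is_m div_mult_self3 div_less add_0
        mod_less mod_mult_self3 not_less0 nat_neq_iff)
  then show ?thesis
    using assms unfolding adj_matrix_def by auto
qed

lemma adj_matrix_outside:
  assumes "a \<ge> i * i"
  shows "adj_matrix i F a = 0"
  using assms index_less unfolding adj_matrix_def by fastforce

text \<open>A singleton is never an edge, so copying the entry is correct on the diagonal even for a
  member of \<open>S\<close>.\<close>

lemma complement_edge_iff: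
  assumes "u < i" "v < i" "E \<subseteq> nsets V 2"
  shows "{u, v} \<in> snd (subgraph_complement ({..<i}, E) S) \<longleftrightarrow>
         (if u \<in> S \<and> v \<in> S \<and> u \<noteq> v then {u, v} \<notin> E else {u, v} \<in> E)"
proof -
  have "u \<noteq> v" if "{u, v} \<in> E"
    using that assms(3) by (auto simp: nsets_def)
  then show ?thesis
    using assms(1,2) unfolding subgraph_complement_def
    by (auto simp: doubleton_eq_iff insert_commute)
qed

text \<open>The matrix is written from its last entry down to its first, so the part already written is
  always a final segment of the addresses.\<close>

definition filled :: "nat \<Rightarrow> (nat \<Rightarrow> nat) \<Rightarrow> state \<Rightarrow> nat \<Rightarrow> state \<Rightarrow> bool" where
  "filled B A z0 b z \<longleftrightarrow>
     virtual B z = (\<lambda>a. if b \<le> a then A a else 0) \<and> (\<forall>a. snd z (addr B 1 a) \<le> fst z 10) \<and>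
     (\<forall>r\<ge>10. fst z r = fst z0 r) \<and>
     (\<forall>a<B. snd z a = snd z0 a) \<and> (\<forall>x. snd z (addr B 2 x) = snd z0 (addr B 2 x))"

lemma filled_step:
  "f = (\<lambda>a. if Suc b \<le> a then A a else 0) \<Longrightarrow> x = A b \<Longrightarrow>
     f(b := x) = (\<lambda>a. if b \<le> a then A a else 0)"
  by (auto simp: fun_eq_iff)

context
  fixes n i :: nat and E :: "nat set set" and S :: "nat set" and z0 :: state and A :: "nat \<Rightarrow> nat"
  assumes E: "E \<subseteq> nsets {..<n} 2" and lay: "layout n E S z0" and i: "fst z0 17 = i" "i \<le> n"
  defines "A \<equiv> adj_matrix i (snd (subgraph_complement ({..<i}, E) S))"
begin

lemma run_fill_cell:
  assumes f: "filled (n * n) A z0 (u * i + Suc v) z" and u: "u < i" and v: "v < i"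
    and z: "fst z 4 = u" "fst z 5 = Suc v" "fst z 6 = u * n" "fst z 7 = u * i"
      "fst z 8 = of_bool (u \<in> S)"
  shows "run fill_cell z 26 (\<lambda>z'. filled (n * n) A z0 (u * i + v) z' \<and> fst z' 4 = u \<and> fst z' 5 = v \<and>
     fst z' 6 = u * n \<and> fst z' 7 = u * i \<and> fst z' 8 = of_bool (u \<in> S))"
proof -
  obtain R M where zz: "z = (R, M)" by force
  have un: "u < n" "v < n" using u v i by auto
  have "u * n + v < n * n" using index_less[OF un] .
  then have regs: "R 12 = 1" "R 13 = n" "R 14 = n * n" "R 15 = Suc (n * n)" "R 16 = Suc (Suc (n * n))"
      "M (u * n + v) = of_bool ({u, v} \<in> E)" "M (addr (n * n) 2 v) = of_bool (v \<in> S)"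
    using f lay un by (auto simp: zz filled_def layout_def)
  have entry: "A (u * i + v) = of_bool (if u \<in> S \<and> v \<in> S \<and> u \<noteq> v then {u, v} \<notin> E else {u, v} \<in> E)"
    unfolding A_def adj_matrix_entry[OF u v] complement_edge_iff[OF u v E] by simp
  define b where "b = u * i + v"
  have b: "R 7 + v = b" "R 6 + v = u * n + v" "R 4 = u" "R 5 = Suc v" "R 8 = of_bool (u \<in> S)"
    using z by (auto simp: zz b_def)
  have virt: "(virtual (n * n) (R, M))(b := A b) = (\<lambda>a. if b \<le> a then A a else 0)"
    by (rule filled_step) (use f in \<open>auto simp: filled_def zz b_def\<close>)
  have fr: "R 10 = fst z0 10" "\<forall>a. M (addr (n * n) (Suc 0) a) \<le> R 10" "\<forall>r\<ge>10. R r = fst z0 r"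
    "\<forall>a<n * n. M a = snd z0 a" "\<forall>x. M (addr (n * n) 2 x) = snd z0 (addr (n * n) 2 x)"
    using f by (auto simp: zz filled_def)
  define y where "y = A b"
  have y: "y = of_bool (if u \<in> S \<and> v \<in> S \<and> u \<noteq> v then {u, v} \<notin> E else {u, v} \<in> E)"
    using entry by (simp add: y_def b_def)
  obtain R' M' where e: "effect fill_cell z = (R', M')" by force
  have "M' = M(addr (n * n) (Suc 0) b := R 10, addr (n * n) 0 b := y)"
    using regs b e by (auto simp: zz fill_cell_def store_prog_def y split: if_splits)
  moreover have "R' r = (R(5 := v)) r" if "r \<notin> {0, 1, 2, 3, 9}" for r
    using regs b that e by (auto simp: zz fill_cell_def store_prog_def split: if_splits)
  moreover have "virtual (n * n) (R', M) = virtual (n * n) (R, M)" if "R' 10 = R 10"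
    using that by (auto simp: virtual_def)
  ultimately have Q: "filled (n * n) A z0 (u * i + v) (R', M') \<and> R' 4 = u \<and>
      R' 5 = v \<and> R' 6 = u * n \<and> R' 7 = u * i \<and> R' 8 = of_bool (u \<in> S)"
    unfolding filled_def b_def[symmetric] using z virt fr by (simp add: zz y_def)
  show ?thesis
    by (rule run_straight_le) (use Q in \<open>auto simp: e\<close>, auto simp: fill_cell_def store_prog_def)
qed

lemma run_fill_row:
  assumes f: "filled (n * n) A z0 (Suc u * i) z" and u: "u < i" and z: "fst z 4 = Suc u"
  shows "run fill_row z (40 * (i + 1)) (\<lambda>z'. filled (n * n) A z0 (u * i) z' \<and> fst z' 4 = u)"
proof -
  obtain R M where zz: "z = (R, M)" by force
  have regs: "R 12 = 1" "R 13 = n" "R 16 = Suc (Suc (n * n))" "R 17 = i"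
      "M (addr (n * n) 2 u) = of_bool (u \<in> S)"
    using f lay u i by (auto simp: zz filled_def layout_def)
  \<comment> \<open>The conjunct \<open>v \<le> i\<close> places column \<open>v\<close> inside the
    row whenever the invariant holds for \<open>Suc v\<close>.\<close>
  let ?I = "\<lambda>v z'. filled (n * n) A z0 (u * i + v) z' \<and> fst z' 4 = u \<and> fst z' 5 = v \<and>
     fst z' 6 = u * n \<and> fst z' 7 = u * i \<and> fst z' 8 = of_bool (u \<in> S) \<and> v \<le> i"
  define z1 where "z1 = (R(4 := u, 6 := u * n, 7 := u * i, 9 := 0, 8 := of_bool (u \<in> S), 5 := i), M)"
  have I: "?I i z1"
    using f by (auto simp: zz z1_def filled_def add.commute)
  have "run (WhileNZ 5 fill_cell) z1 (i * (26 + 1) + 1) (?I 0)"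
  proof (rule run_WhileNZ[where I = ?I])
    show "run fill_cell z' 26 (?I v)" if "?I (Suc v) z'" for v z'
      by (rule run_mono[OF run_fill_cell[of u v z']]) (use that u in auto)
  qed (use I in auto)
  then have "run ((Add 8 4 4 ;; Add 8 8 4 ;; Add 8 8 16 ;; Load 8 8 ;; Move 5 17) ;; WhileNZ 5 fill_cell)
      (R(4 := u, 6 := u * n, 7 := u * i, 9 := 0), M) (6 + i * 27) (?I 0)"
    by (rule run_straight_then) (use regs in \<open>auto simp: z1_def\<close>)
  then have "run (mul_prog 12 7 4 17 9 ;;
      (Add 8 4 4 ;; Add 8 8 4 ;; Add 8 8 16 ;; Load 8 8 ;; Move 5 17) ;; WhileNZ 5 fill_cell)
      (R(4 := u, 6 := u * n, 9 := 0), M) (9 + i * 30) (?I 0)"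
    by (rule run_mul_then) (use regs u in \<open>auto simp: fun_eq_iff\<close>)
  then have "run (mul_prog 12 6 4 13 9 ;; mul_prog 12 7 4 17 9 ;;
      (Add 8 4 4 ;; Add 8 8 4 ;; Add 8 8 16 ;; Load 8 8 ;; Move 5 17) ;; WhileNZ 5 fill_cell)
      (R(4 := u), M) (12 + i * 33) (?I 0)"
    by (rule run_mul_then) (use regs u in \<open>auto simp: fun_eq_iff\<close>)
  then have "run fill_row z (13 + i * 33) (?I 0)"
    unfolding fill_row_def by (rule run_straight_then) (use regs z in \<open>auto simp: zz\<close>)
  then show ?thesis
    by (rule run_mono) auto
qed

lemma run_fill_matrix:
  assumes "filled (n * n) A z0 (i * i) z"
  shows "run fill_matrix z (50 * (i + 1)\<^sup>2) (filled (n * n) A z0 0)"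
proof -
  obtain R M where zz: "z = (R, M)" by force
  have R: "R 17 = i"
    using assms i by (auto simp: zz filled_def)
  let ?I = "\<lambda>u z'. filled (n * n) A z0 (u * i) z' \<and> fst z' 4 = u \<and> u \<le> i"
  have "run (WhileNZ 4 fill_row) (R(4 := i), M) (i * (40 * (i + 1) + 1) + 1) (?I 0)"
  proof (rule run_WhileNZ[where I = ?I])
    show "run fill_row z' (40 * (i + 1)) (?I u)" if "?I (Suc u) z'" for u z'
      by (rule run_mono[OF run_fill_row[of u z']]) (use that in auto)
    show "?I i (R(4 := i), M)"
      using assms by (auto simp: zz filled_def)
  qed auto
  then have "run fill_matrix z (i * (40 * (i + 1) + 1) + 2) (?I 0)"
    unfolding fill_matrix_def by (rule run_straight_then) (auto simp: zz R)
  then show ?thesis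
    by (rule run_mono) (auto simp: power2_eq_square algebra_simps)
qed

end

text \<open>The frame starts at register 12 because a trial changes the call number and the answer.
  Input and vertex set survive, so trials can be repeated on the same data.\<close>

lemma run_trial:
  assumes E: "E \<subseteq> nsets {..<n} 2" and lay: "layout n E S z0" and i: "fst z0 17 = i" "i \<le> n"
    and L: "L \<ge> 20" and N: "N \<ge> 1" "regs_below N c" and c: "decides_within c P T"
  shows "run (trial L N c) z0 (50 * (i + 1)\<^sup>2 + 8 * T i + N + 4) (\<lambda>z. layout n E S z \<and>
     (\<forall>r. 12 \<le> r \<and> r < L \<longrightarrow> fst z r = fst z0 r) \<and>
     fst z 11 = of_bool (P (subgraph_complement ({..<i}, E) S)))"
proof -
  obtain R M where z0: "z0 = (R, M)" by force
  define F where "F = snd (subgraph_complement ({..<i}, E) S)"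
  have F: "subgraph_complement ({..<i}, E) S = ({..<i}, F)"
    by (simp add: F_def subgraph_complement_def)
  have "simple_graph ({..<i}, F)"
    unfolding F_def simple_graph_def subgraph_complement_def by (auto simp: nsets_def)
  then obtain k s where k: "exec c (input_state i F) k s" "k \<le> T i"
      "fst s 0 = of_bool (P ({..<i}, F))"
    using c unfolding decides_within_def by (metis of_bool_def)
  define z1 where "z1 = (R(10 := Suc (R 10)), M)"
  have le: "M (addr (n * n) (Suc 0) a) < Suc (R 10)" for a
    using lay by (auto simp: layout_def z0 less_Suc_eq_le)
  have lay1: "layout n E S z1"
    using lay le by (auto simp: layout_def z0 z1_def less_Suc_eq_le le_SucI)
  have i1: "fst z1 17 = i"
    using i(1) by (simp add: z1_def z0)
  let ?A = "adj_matrix i F"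
  have "filled (n * n) ?A z1 (i * i) z1"
    unfolding filled_def using less_imp_neq[OF le] less_imp_le[OF le]
    by (auto simp: z1_def virtual_def adj_matrix_outside fun_eq_iff)
  then have fill: "run fill_matrix z1 (50 * (i + 1)\<^sup>2) (filled (n * n) ?A z1 0)"
    unfolding F_def by (rule run_fill_matrix[OF E lay1 i1 i(2)])
  let ?Q = "\<lambda>z. layout n E S z \<and> (\<forall>r. 12 \<le> r \<and> r < L \<longrightarrow> fst z r = fst z0 r) \<and>
     fst z 11 = of_bool (P (subgraph_complement ({..<i}, E) S))"
  have rest: "run ((zero_regs L N ;; Move L 17) ;; sandbox L c ;; Move 11 L) z (N + 2 + 8 * T i + 1) ?Q"
    if z: "filled (n * n) ?A z1 0 z" for z
  proof -
    obtain R' M' where zz: "z = (R', M')" by force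
    define z2 where "z2 = effect (zero_regs L N ;; Move L 17) z"
    have z2: "z2 = ((\<lambda>r. if L \<le> r \<and> r < L + N then 0 else R' r)(L := R' 17), M')"
      using L by (auto simp: z2_def zz)
    have R': "R' r = R r" if "11 \<le> r" for r
      using z that by (simp add: zz z1_def filled_def)
    have virt: "virtual (n * n) z2 = snd (input_state i F)"
    proof -
      have "virtual (n * n) z2 = virtual (n * n) z"
        using L by (simp add: virtual_def fun_eq_iff zz z2)
      also have "\<dots> = ?A"
        using z by (simp add: filled_def)
      also have "\<dots> = snd (input_state i F)"
        by (simp add: input_state_def adj_matrix_def fun_eq_iff)
      finally show ?thesis .
    qed
    \<comment> \<open>The virtual memory and the zeroed bank with \<open>i\<close> in its first
      register form the initial state of \<open>c\<close>, so the halting run of \<open>c\<close>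
      carries over.\<close>
    have sim: "simulates L N (n * n) z2 (input_state i F) z2"
      unfolding simulates_def virt
      using z L R' i by (auto simp: filled_def zz z2 input_state_def z0)
    have base: "fst z2 14 = n * n" "fst z2 15 = n * n + 1"
      using lay L R' by (auto simp: z2 layout_def z0)
    have "run (sandbox L c) z2 (8 * k) (simulates L N (n * n) z2 s)"
      by (rule run_sandbox[OF k(1) N(2) sim L base])
    then have "run (sandbox L c ;; Move 11 L) z2 (8 * k + cost (Move 11 L)) ?Q"
    proof (rule run_Seq_straight[OF run_mono])
      fix z3 assume z3: "simulates L N (n * n) z2 s z3"
      obtain R3 M3 where zz3: "z3 = (R3, M3)" by force
      have R3: "R3 r = R r" if "11 \<le> r" "r < L" for r
        using z3 that R' by (auto simp: zz3 simulates_def z2)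
      have M3: "M3 a = M a" if "a < n * n" for a
        using z3 z that by (auto simp: zz3 simulates_def z2 filled_def zz z1_def)
      have M3': "M3 (addr (n * n) 2 x) = M (addr (n * n) 2 x)" for x
        using z3 z by (auto simp: zz3 simulates_def z2 filled_def zz z1_def)
      have M3'': "M3 (addr (n * n) (Suc 0) x) \<le> R3 10" for x
        using z3 by (auto simp: zz3 simulates_def)
      have "R3 L = fst s 0"
        using z3 N(1) unfolding simulates_def zz3 by (metis add.right_neutral fst_conv less_le_trans zero_less_one)
      then show "?Q (effect (Move 11 L) z3)"
        using index_less lay R3 M3 M3' M3'' k(3) L by (auto simp: layout_def zz3 z0 F)
    qed auto
    then show ?thesis
      by (rule run_straight_then) (use k(2) in \<open>auto simp: z2_def\<close>)
  qed
  from run_Seq[OF fill rest] have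
    "run (fill_matrix ;; (zero_regs L N ;; Move L 17) ;; sandbox L c ;; Move 11 L) z1
       (50 * (i + 1)\<^sup>2 + (N + 2 + 8 * T i + 1)) ?Q" by blast
  then show ?thesis
    unfolding trial_def by (rule run_straight_then) (use lay in \<open>auto simp: z0 z1_def layout_def\<close>)
qed

section \<open>Searching among nearby vertex sets\<close>

definition flip :: "'a \<Rightarrow> 'a set \<Rightarrow> 'a set" where
  "flip x S = {y. (y \<in> S) \<noteq> (y = x)}"

lemma flip_flip [simp]: "flip x (flip x S) = S"
  by (auto simp: flip_def)

text \<open>The index \<open>x = i\<close> lies outside the graph on \<open>{..<i}\<close> and serves as a dummy: flipping it allows for
  fewer than \<open>k\<close> effective flips.\<close>

fun near :: "nat \<Rightarrow> nat \<Rightarrow> nat set \<Rightarrow> nat set set" where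
  "near i 0 S = {S}"
| "near i (Suc k) S = (\<Union>x\<le>i. near i k (flip x S))"

text \<open>Each flip can remove one disagreement below \<open>i\<close>; once none is left, the
  remaining flips are spent on \<open>i\<close> itself.\<close>

lemma near_covers:
  "card {x. x < i \<and> (x \<in> S) \<noteq> (x \<in> X)} \<le> k \<Longrightarrow> \<exists>Y\<in>near i k S. \<forall>x<i. x \<in> Y \<longleftrightarrow> x \<in> X"
proof (induction k arbitrary: S)
  case 0
  then have "{x. x < i \<and> (x \<in> S) \<noteq> (x \<in> X)} = {}"
    by (subst (asm) le_zero_eq, subst (asm) card_0_eq) auto
  then show ?case by auto
next
  case (Suc k)
  define D where "D S = {x. x < i \<and> (x \<in> S) \<noteq> (x \<in> X)}" for S
  have fin: "finite (D S)" for S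
    by (auto simp: D_def)
  have le: "card (D S) \<le> Suc k"
    using Suc.prems unfolding D_def .
  obtain x where x: "x \<le> i" "card (D (flip x S)) \<le> k"
  proof (cases "D S = {}")
    case True
    have "D (flip i S) = D S"
      by (auto simp: D_def flip_def)
    then show ?thesis
      using that[of i] True by simp
  next
    case False
    then obtain x where x: "x \<in> D S" by blast
    have "D (flip x S) = D S - {x}"
      using x by (auto simp: D_def flip_def)
    then have "card (D (flip x S)) \<le> k"
      using le x fin[of S] by simp
    then show ?thesis
      using that[of x] x by (auto simp: D_def)
  qed
  then show ?case
    using Suc.IH[of "flip x S"] by (auto simp: D_def)
qed

definition flip_prog :: "reg \<Rightarrow> prog" where
  "flip_prog r = Add 0 r r ;; Add 0 0 r ;; Add 0 0 16 ;; Load 1 0 ;; Sub 1 12 1 ;; Store 0 1"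

lemma straight_flip_prog [simp]: "straight (flip_prog r)" "cost (flip_prog r) = 6"
  by (auto simp: flip_prog_def)

lemma effect_flip_prog:
  assumes "layout n E S z" "fst z r \<le> n" "r \<ge> 2"
  shows "layout n E (flip (fst z r) S) (effect (flip_prog r) z)"
    and "r' \<ge> 2 \<Longrightarrow> fst (effect (flip_prog r) z) r' = fst z r'"
proof -
  obtain R M where z: "z = (R, M)" by force
  have eq: "effect (flip_prog r) z =
      (R(0 := addr (n * n) 2 (R r), 1 := of_bool (R r \<notin> S)),
       M(addr (n * n) 2 (R r) := of_bool (R r \<notin> S)))"
    using assms by (auto simp: flip_prog_def z layout_def)
  have "u * n + v \<noteq> addr (n * n) 2 x" if "u < n" "v < n" for u v x
    using index_less[OF that] by simp
  then show "layout n E (flip (fst z r) S) (effect (flip_prog r) z)"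
    using assms unfolding eq by (auto simp: z layout_def flip_def)
  show "fst (effect (flip_prog r) z) r' = fst z r'" if "r' \<ge> 2"
    using that unfolding eq by (auto simp: z)
qed

text \<open>The loops are unrolled in the program text, one counter register per flip, since the
  number of flips is a constant. Register 11 doubles as exit flag: after a success the remaining
  rounds are skipped and no flip is undone, so the successful set stays in memory.\<close>

fun search :: "nat \<Rightarrow> prog \<Rightarrow> prog" where
  "search 0 c = c"
| "search (Suc k) c =
     (Move (20 + k) 17 ;; Add (20 + k) (20 + k) 12) ;;
     WhileNZ (20 + k)
       (Sub (20 + k) (20 + k) 12 ;;
        IfNZ 11 Skip (flip_prog (20 + k) ;; search k c ;; IfNZ 11 Skip (flip_prog (20 + k))))"

text \<open>Failure must restore \<open>S\<close>, because the enclosing loop continues from it. The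
  registers from 20 to \<open>20 + k - 1\<close> are the counters of these \<open>k\<close> loops;
  the counters of enclosing loops are preserved.\<close>

definition search_post ::
  "nat \<Rightarrow> nat \<Rightarrow> nat set set \<Rightarrow> nat set \<Rightarrow> (nat set \<Rightarrow> bool) \<Rightarrow> nat \<Rightarrow> nat set set \<Rightarrow> state \<Rightarrow> state \<Rightarrow> bool"
where
  "search_post L n E S P k C z z' \<longleftrightarrow> (\<exists>S'. layout n E S' z' \<and>
     (\<forall>r. 12 \<le> r \<and> r < L \<and> (r < 20 \<or> 20 + k \<le> r) \<longrightarrow> fst z' r = fst z r) \<and>
     (fst z' 11 = 1 \<and> P S' \<or> fst z' 11 = 0 \<and> S' = S \<and> (\<forall>X\<in>C. \<not> P X)))"

lemma run_search:
  assumes trial: "\<And>S z. layout n E S z \<Longrightarrow> fst z 17 = i \<Longrightarrow>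
      run c z \<tau> (\<lambda>z'. layout n E S z' \<and> (\<forall>r. 12 \<le> r \<and> r < L \<longrightarrow> fst z' r = fst z r) \<and>
        fst z' 11 = of_bool (P S))"
    and i: "i \<le> n" and "\<tau> \<ge> 1"
    and "20 + k \<le> L" "layout n E S z" "fst z 17 = i" "fst z 11 = 0"
  shows "run (search k c) z ((20 * (n + 1)) ^ k * \<tau>) (search_post L n E S P k (near i k S) z)"
  using assms(4-)
proof (induction k arbitrary: S z)
  case 0
  show ?case
    by (simp, rule run_mono[OF trial[OF 0(2,3)]]) (auto simp: search_post_def)
next
  case (Suc k)
  define T where "T = (20 * (n + 1)) ^ k * \<tau>"
  have "T \<ge> 1"
    using assms(3) by (simp add: T_def)
  define x where "x = 20 + k"
  have x: "20 \<le> x" "x < L" "x = 20 + k"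
    using Suc.prems by (auto simp: x_def)
  define body where "body = Sub x x 12 ;;
        IfNZ 11 Skip (flip_prog x ;; search k c ;; IfNZ 11 Skip (flip_prog x))"
  \<comment> \<open>Counting down, the loop has dealt with the outermost flips
    \<open>y \<ge> m\<close> when the counter shows \<open>m\<close>; the start at
    \<open>i + 1\<close> includes the dummy \<open>i\<close>.\<close>
  define I where "I m z' \<longleftrightarrow> fst z' x = m \<and> m \<le> i + 1 \<and>
      search_post L n E S P (Suc k) (\<Union>y\<in>{m..i}. near i k (flip y S)) z z'" for m z'
  have step: "run body z1 (T + 15) (I m)" if I: "I (Suc m) z1" for m z1
  proof -
    obtain S1 where S1: "layout n E S1 z1"
        "\<And>r. 12 \<le> r \<Longrightarrow> r < L \<Longrightarrow> r < 20 \<or> 20 + Suc k \<le> r \<Longrightarrow> fst z1 r = fst z r"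
        "fst z1 11 = 1 \<and> P S1 \<or> fst z1 11 = 0 \<and> S1 = S \<and> (\<forall>y\<in>{Suc m..i}. \<forall>X\<in>near i k (flip y S). \<not> P X)"
        "fst z1 x = Suc m" "m \<le> i"
      using I unfolding I_def search_post_def by auto
    define z2 where "z2 = effect (Sub x x 12) z1"
    have z2: "z2 = ((fst z1)(x := m), snd z1)"
      using S1 by (cases z1) (auto simp: z2_def layout_def)
    have lay2: "layout n E S1 z2"
      using S1(1) x by (auto simp: z2 layout_def)
    have fr2: "fst z2 r = fst z r" if "12 \<le> r" "r < L" "r < 20 \<or> 20 + Suc k \<le> r" for r
      using S1(2)[OF that] that x by (auto simp: z2)
    have x2: "fst z2 x = m" "fst z2 11 = fst z1 11"
      using x by (auto simp: z2)
    have "run (IfNZ 11 Skip (flip_prog x ;; search k c ;; IfNZ 11 Skip (flip_prog x))) z2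
        (1 + (13 + T)) (I m)"
    proof (rule run_IfNZ)
      assume "fst z2 11 \<noteq> 0"
      then have "I m z2"
        unfolding I_def search_post_def using lay2 fr2 x2 S1(3,5) by auto
      then show "run Skip z2 (13 + T) (I m)"
        by (intro run_straight_le) auto
    next
      assume "fst z2 11 = 0"
      then have nf: "fst z1 11 = 0" "S1 = S" "\<And>y X. y \<in> {Suc m..i} \<Longrightarrow> X \<in> near i k (flip y S) \<Longrightarrow> \<not> P X"
        using S1(3) x2 by auto
      define z3 where "z3 = effect (flip_prog x) z2"
      have "fst z2 x \<le> n" "2 \<le> x" using x2 S1(5) i x by auto
      note fl = effect_flip_prog[OF lay2 this, folded z3_def]
      have lay3: "layout n E (flip m S) z3"
        using fl(1) x2 nf(2) by simp
      have post: "run (search k c) z3 T (search_post L n E (flip m S) P k (near i k (flip m S)) z3)"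
        unfolding T_def by (rule Suc.IH[OF _ lay3]) (use Suc.prems fl(2) fr2 x2 nf in auto)
      have "run (search k c ;; IfNZ 11 Skip (flip_prog x)) z3 (T + 7) (I m)"
      proof (rule run_Seq[OF post])
        fix z4 assume "search_post L n E (flip m S) P k (near i k (flip m S)) z3 z4"
        then obtain S4 where S4: "layout n E S4 z4"
            "\<And>r. 12 \<le> r \<Longrightarrow> r < L \<Longrightarrow> r < 20 \<or> 20 + k \<le> r \<Longrightarrow> fst z4 r = fst z3 r"
            "fst z4 11 = 1 \<and> P S4 \<or> fst z4 11 = 0 \<and> S4 = flip m S \<and> (\<forall>X\<in>near i k (flip m S). \<not> P X)"
          unfolding search_post_def by auto
        have x4: "fst z4 x = m"
          using S4(2)[of x] x fl(2)[of x] x2 by auto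
        have fr4: "fst z4 r = fst z r" if "12 \<le> r" "r < L" "r < 20 \<or> 20 + Suc k \<le> r" for r
          using S4(2)[of r] fl(2)[of r] fr2[of r] that by auto
        have "run (IfNZ 11 Skip (flip_prog x)) z4 (1 + 6) (I m)"
        proof (rule run_IfNZ)
          assume "fst z4 11 \<noteq> 0"
          then have "I m z4"
            unfolding I_def search_post_def using S4 fr4 x4 S1(5) by auto
          then show "run Skip z4 6 (I m)"
            by (intro run_straight_le) auto
        next
          assume "fst z4 11 = 0"
          then have nf4: "S4 = flip m S" "\<forall>X\<in>near i k (flip m S). \<not> P X"
            using S4(3) by auto
          have "fst z4 x \<le> n" using x4 S1(5) i by simp
          note fl4 = effect_flip_prog[OF S4(1) this \<open>2 \<le> x\<close>]
          have "I m (effect (flip_prog x) z4)"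
            unfolding I_def search_post_def
          proof (intro conjI exI[of _ S])
            show "layout n E S (effect (flip_prog x) z4)"
              using fl4(1) x4 nf4 by simp
            have "\<not> P X" if "y \<in> {m..i}" "X \<in> near i k (flip y S)" for y X
              using nf(3)[of y X] nf4(2) that by (cases "y = m") auto
            then show "fst (effect (flip_prog x) z4) 11 = 1 \<and> P S \<or>
                fst (effect (flip_prog x) z4) 11 = 0 \<and> S = S \<and>
                (\<forall>X\<in>\<Union>y\<in>{m..i}. near i k (flip y S). \<not> P X)"
              using fl4(2)[of 11] \<open>fst z4 11 = 0\<close> by auto
          qed (use fl4(2) x4 fr4 x S1(5) in auto)
          then show "run (flip_prog x) z4 6 (I m)"
            by (intro run_straight_le) auto
        qed
        then show "run (IfNZ 11 Skip (flip_prog x)) z4 7 (I m)" by simp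
      qed
      then show "run (flip_prog x ;; search k c ;; IfNZ 11 Skip (flip_prog x)) z2 (13 + T) (I m)"
        by (rule run_straight_then) (auto simp: z3_def)
    qed
    then show ?thesis
      unfolding body_def by (rule run_straight_then) (auto simp: z2_def)
  qed
  obtain R M where z: "z = (R, M)" by force
  define z1 where "z1 = ((fst z)(x := i + 1), snd z)"
  have "I (i + 1) z1"
    unfolding I_def search_post_def using Suc.prems x
    by (auto simp: z1_def layout_def intro!: exI[of _ S])
  then have "run (WhileNZ x body) z1 ((i + 1) * (T + 15 + 1) + 1) (I 0)"
    by (rule run_WhileNZ[where I = I, rotated -1]) (use step in \<open>auto simp: I_def\<close>)
  then have "run (search (Suc k) c) z ((i + 1) * (T + 15 + 1) + 3) (I 0)"
    unfolding search.simps x(3)[symmetric] body_def[symmetric]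
    by (rule run_straight_then) (use Suc.prems x in \<open>auto simp: z z1_def layout_def\<close>)
  \<comment> \<open>Origin of the factor 20: as \<open>T \<ge> 1\<close>, a round costs at most
    \<open>17 * T\<close>, and the additive 3 is at most \<open>3 * ((n + 1) * T)\<close>.\<close>
  moreover have "(i + 1) * (T + 15 + 1) + 3 \<le> (20 * (n + 1)) ^ Suc k * \<tau>"
  proof -
    have "(i + 1) * (T + 15 + 1) + 3 \<le> (n + 1) * (17 * T) + 3 * ((n + 1) * T)"
      using i \<open>T \<ge> 1\<close> by (intro add_mono mult_mono) auto
    then show ?thesis
      by (simp add: T_def algebra_simps)
  qed
  ultimately show ?case
    by (rule run_mono) (auto simp: I_def search_post_def atLeast0AtMost)
qed


section \<open>The complete program\<close>

definition init_prog :: prog where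
  "init_prog = (Const 12 1 ;; Move 13 0) ;; mul_prog 12 14 13 13 1 ;;
     Add 15 14 12 ;; Add 16 15 12 ;; Move 18 13"

definition main_prog :: "nat \<Rightarrow> nat \<Rightarrow> prog \<Rightarrow> prog \<Rightarrow> prog" where
  "main_prog N k c1 c2 =
     init_prog ;;
     WhileNZ 18 ((Sub 18 18 12 ;; Add 17 17 12 ;; Const 11 0) ;; search k (trial (20 + k) N c1)) ;;
     Const 11 0 ;; search k (trial (20 + k) N c2) ;; Move 0 11"

lemma run_init_prog:
  "run init_prog (input_state n E) (3 * n + 8)
     (\<lambda>z. layout n E {} z \<and> fst z 17 = 0 \<and> fst z 18 = n)"
proof -
  define R :: "nat \<Rightarrow> nat" where "R = (\<lambda>r. if r = 0 then n else 0)"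
  define M where "M = adj_matrix n E"
  have s: "input_state n E = (R, M)"
    by (auto simp: input_state_def R_def M_def adj_matrix_def fun_eq_iff)
  define R' where "R' = R(12 := 1, 13 := n, 14 := n * n, 1 := 0)"
  define z where "z = (R'(15 := n * n + 1, 16 := n * n + 2, 18 := n), M)"
  have zero: "M (addr (n * n) j x) = 0" for j x
    unfolding M_def by (rule adj_matrix_outside) (simp add: addr_def)
  have Q: "layout n E {} z \<and> fst z 17 = 0 \<and> fst z 18 = n"
    using zero by (auto simp: z_def layout_def R'_def R_def M_def adj_matrix_entry)
  have "run (Add 15 14 12 ;; Add 16 15 12 ;; Move 18 13) (R', M) 3
      (\<lambda>z. layout n E {} z \<and> fst z 17 = 0 \<and> fst z 18 = n)"
    by (rule run_straight_le) (use Q in \<open>auto simp: z_def R'_def\<close>)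
  then have "run (mul_prog 12 14 13 13 1 ;; Add 15 14 12 ;; Add 16 15 12 ;; Move 18 13)
      (R(12 := 1, 13 := n), M) (3 * n + 6) (\<lambda>z. layout n E {} z \<and> fst z 17 = 0 \<and> fst z 18 = n)"
    by (rule run_mul_then) (auto simp: R'_def fun_eq_iff)
  then show ?thesis
    unfolding init_prog_def s by (rule run_straight_then) (auto simp: R_def)
qed

text \<open>\<open>P1\<close> guides the growth and \<open>P2\<close> is the property sought. The
  hypotheses \<open>start\<close>, \<open>extend\<close> and \<open>finish\<close> are all that the
  machine part asks of the combinatorics; the last two presuppose a solution \<open>X\<close>, so
  the loop invariant is an implication from its existence.\<close>

lemma run_main_prog:
  fixes n N :: nat and E :: "nat set set"
  defines "G \<equiv> \<lambda>i S. subgraph_complement ({..<i}, E) S"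
  defines "\<tau> \<equiv> \<lambda>T. 50 * (n + 1)\<^sup>2 + 8 * T n + N + 4"
  assumes E: "E \<subseteq> nsets {..<n} 2"
    and N: "N \<ge> 1" "regs_below N c1" "regs_below N c2"
    and c1: "decides_within c1 P1 T1" and c2: "decides_within c2 P2 T2" and T1: "mono T1"
    and start: "\<And>S. P1 (G 0 S)"
    and extend: "\<And>i S X. i < n \<Longrightarrow> P2 (G n X) \<Longrightarrow> P1 (G i S) \<Longrightarrow> \<exists>Y\<in>near (Suc i) k S. P1 (G (Suc i) Y)"
    and finish: "\<And>S X. P2 (G n X) \<Longrightarrow> P1 (G n S) \<Longrightarrow> \<exists>Y\<in>near n k S. P2 (G n Y)"
  shows "run (main_prog N k c1 c2) (input_state n E)
    (3 * n + 11 + n * ((20 * (n + 1)) ^ k * \<tau> T1 + 4) + (20 * (n + 1)) ^ k * \<tau> T2)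
    (\<lambda>z. fst z 0 = of_bool (\<exists>X. P2 (G n X)))"
proof -
  define C1 where "C1 = search k (trial (20 + k) N c1)"
  define C2 where "C2 = search k (trial (20 + k) N c2)"
  define W1 where "W1 = (20 * (n + 1)) ^ k * \<tau> T1"
  define W2 where "W2 = (20 * (n + 1)) ^ k * \<tau> T2"
  have C1: "run C1 z W1 (search_post (20 + k) n E S (\<lambda>S. P1 (G i S)) k (near i k S) z)"
    if "layout n E S z" "fst z 17 = i" "i \<le> n" "fst z 11 = 0" for S z i
    unfolding C1_def W1_def
  proof (rule run_search)
    fix S z assume z: "layout n E S z" "fst z 17 = i"
    \<comment> \<open>Trials with \<open>c1\<close> run on \<open>i \<le> n\<close> vertices;
      monotonicity of \<open>T1\<close> charges them all at size \<open>n\<close>.\<close>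
    have "50 * (i + 1)\<^sup>2 + 8 * T1 i + N + 4 \<le> \<tau> T1"
      unfolding \<tau>_def using that(3) monoD[OF T1 that(3)] by (intro add_mono mult_mono power_mono) auto
    then show "run (trial (20 + k) N c1) z (\<tau> T1) (\<lambda>z'. layout n E S z' \<and>
        (\<forall>r. 12 \<le> r \<and> r < 20 + k \<longrightarrow> fst z' r = fst z r) \<and> fst z' 11 = of_bool (P1 (G i S)))"
      unfolding G_def
      by (rule run_mono[OF run_trial[OF E z that(3) _ N(1,2) c1, of "20 + k"], rotated]) auto
  qed (use that in \<open>auto simp: \<tau>_def\<close>)
  have C2: "run C2 z W2 (search_post (20 + k) n E S (\<lambda>S. P2 (G n S)) k (near n k S) z)"
    if "layout n E S z" "fst z 17 = n" "fst z 11 = 0" for S z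
    unfolding C2_def W2_def
  proof (rule run_search)
    fix S z assume z: "layout n E S z" "fst z 17 = n"
    show "run (trial (20 + k) N c2) z (\<tau> T2) (\<lambda>z'. layout n E S z' \<and>
        (\<forall>r. 12 \<le> r \<and> r < 20 + k \<longrightarrow> fst z' r = fst z r) \<and> fst z' 11 = of_bool (P2 (G n S)))"
      unfolding G_def \<tau>_def
      by (rule run_trial[OF E z order.refl _ N(1,3) c2, of "20 + k"]) auto
  qed (use that in \<open>auto simp: \<tau>_def\<close>)
  define I where "I m z \<longleftrightarrow> fst z 18 = m \<and> m \<le> n \<and> fst z 17 = n - m \<and>
    (\<exists>S. layout n E S z \<and> ((\<exists>X. P2 (G n X)) \<longrightarrow> P1 (G (n - m) S)))" for m z
  have step: "run ((Sub 18 18 12 ;; Add 17 17 12 ;; Const 11 0) ;; C1) z (W1 + 3) (I m)"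
    if I: "I (Suc m) z" for m z
  proof -
    define i where "i = n - Suc m"
    obtain S where S: "layout n E S z" "(\<exists>X. P2 (G n X)) \<longrightarrow> P1 (G i S)"
        "fst z 18 = Suc m" "Suc m \<le> n" "fst z 17 = i"
      using I by (auto simp: I_def i_def)
    obtain R M where z: "z = (R, M)" by force
    define z1 where "z1 = (R(18 := m, 17 := Suc i, 11 := 0), M)"
    have i: "Suc i \<le> n" "Suc i = n - m" using S(4) by (auto simp: i_def)
    have "run C1 z1 W1 (search_post (20 + k) n E S (\<lambda>S. P1 (G (Suc i) S)) k (near (Suc i) k S) z1)"
      using S(1) i by (intro C1) (auto simp: z1_def z layout_def)
    then have "run C1 z1 W1 (I m)"
    proof (rule run_mono)
      fix z2 assume "search_post (20 + k) n E S (\<lambda>S. P1 (G (Suc i) S)) k (near (Suc i) k S) z1 z2"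
      then obtain S2 where S2: "layout n E S2 z2" "fst z2 17 = Suc i" "fst z2 18 = m"
          "P1 (G (Suc i) S2) \<or> (\<forall>Y\<in>near (Suc i) k S. \<not> P1 (G (Suc i) Y))"
        by (auto simp: search_post_def z1_def)
      have "P1 (G (Suc i) S2)" if "P2 (G n X)" for X
        using extend[of i X S] that S(2) S2(4) i by auto
      then show "I m z2"
        using S2 S(4) i by (auto simp: I_def)
    qed auto
    then show ?thesis
      by (rule run_straight_then) (use S in \<open>auto simp: z1_def z layout_def\<close>)
  qed
  have loop: "run (WhileNZ 18 ((Sub 18 18 12 ;; Add 17 17 12 ;; Const 11 0) ;; C1)) z
      (n * (W1 + 3 + 1) + 1) (I 0)" if "layout n E {} z \<and> fst z 17 = 0 \<and> fst z 18 = n" for z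
    by (rule run_WhileNZ[where I = I]) (use step that start in \<open>auto simp: I_def\<close>)
  have final: "run (Const 11 0 ;; C2 ;; Move 0 11) z (1 + (W2 + 1))
      (\<lambda>z. fst z 0 = of_bool (\<exists>X. P2 (G n X)))" if I: "I 0 z" for z
  proof -
    obtain S where S: "layout n E S z" "(\<exists>X. P2 (G n X)) \<longrightarrow> P1 (G n S)" "fst z 17 = n"
      using I by (auto simp: I_def)
    obtain R M where z: "z = (R, M)" by force
    define z1 where "z1 = (R(11 := 0), M)"
    have "run C2 z1 W2 (search_post (20 + k) n E S (\<lambda>S. P2 (G n S)) k (near n k S) z1)"
      using S by (intro C2) (auto simp: z1_def z layout_def)
    then have "run (C2 ;; Move 0 11) z1 (W2 + cost (Move 0 11)) (\<lambda>z. fst z 0 = of_bool (\<exists>X. P2 (G n X)))"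
    proof (rule run_Seq_straight[OF run_mono])
      fix z2 assume "search_post (20 + k) n E S (\<lambda>S. P2 (G n S)) k (near n k S) z1 z2"
      then have "fst z2 11 = of_bool (\<exists>X. P2 (G n X))"
        using finish S(2) by (auto simp: search_post_def) 
      then show "fst (effect (Move 0 11) z2) 0 = of_bool (\<exists>X. P2 (G n X))"
        by (cases z2) simp
    qed auto
    then show ?thesis
      by (rule run_straight_then) (auto simp: z1_def z)
  qed
  have "run (main_prog N k c1 c2) (input_state n E)
      (3 * n + 8 + (n * (W1 + 3 + 1) + 1 + (1 + (W2 + 1)))) (\<lambda>z. fst z 0 = of_bool (\<exists>X. P2 (G n X)))"
    unfolding main_prog_def C1_def[symmetric] C2_def[symmetric]
    by (rule run_Seq[OF run_init_prog run_Seq[OF loop final]]) auto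
  then show ?thesis
    by (rule run_mono) (auto simp: W1_def W2_def)
qed

section \<open>Detecting cliques\<close>

text \<open>Register \<open>10 + 2 j\<close> holds the \<open>j\<close>-th vertex \<open>x\<close> of the tuple and register \<open>11 + 2 j\<close> its row offset
  \<open>x n\<close>, which is decremented along with \<open>x\<close>: multiplying afresh would cost an extra factor \<open>n\<close>.\<close>

fun check_pairs :: "(nat \<times> nat) list \<Rightarrow> prog" where
  "check_pairs [] = Skip"
| "check_pairs ((i, j) # ps) =
     (Add 5 (11 + 2 * i) (10 + 2 * j) ;; Load 5 5 ;; IfNZ 5 Skip (Const 4 0)) ;; check_pairs ps"

definition pairs :: "nat \<Rightarrow> (nat \<times> nat) list" where
  "pairs t = filter (\<lambda>(i, j). i < j) (List.product [0..<t] [0..<t])"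

definition check_tuple :: "nat \<Rightarrow> prog" where
  "check_tuple t = Const 4 1 ;; check_pairs (pairs t) ;; IfNZ 4 (Const 3 1) Skip"

fun tuples :: "nat \<Rightarrow> prog \<Rightarrow> prog" where
  "tuples 0 c = c"
| "tuples (Suc k) c =
     (Move (10 + 2 * k) 0 ;; Move (11 + 2 * k) 2) ;;
     WhileNZ (10 + 2 * k)
       ((Sub (10 + 2 * k) (10 + 2 * k) 1 ;; Sub (11 + 2 * k) (11 + 2 * k) 0) ;; tuples k c)"

definition clique_checker :: "nat \<Rightarrow> prog" where
  "clique_checker t =
     Const 1 1 ;; mul_prog 1 2 0 0 6 ;; tuples t (check_tuple t) ;; Sub 0 1 3"

lemma straight_check_pairs [simp]: "straight (check_pairs ps)"
  by (induction ps rule: check_pairs.induct) auto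

lemma straight_check_tuple [simp]: "straight (check_tuple t)"
  by (simp add: check_tuple_def)

lemma effect_check_pairs:
  "\<exists>x. effect (check_pairs ps) (R, M) =
     (R(4 := if \<forall>(i, j)\<in>set ps. M (R (11 + 2 * i) + R (10 + 2 * j)) \<noteq> 0 then R 4 else 0, 5 := x), M)"
proof (induction ps arbitrary: R)
  case Nil
  show ?case by (auto intro!: exI[of _ "R 5"])
next
  case (Cons p ps)
  obtain i j where p: "p = (i, j)" by force
  define y where "y = M (R (11 + 2 * i) + R (10 + 2 * j))"
  define R' where "R' = R(5 := y, 4 := if y \<noteq> 0 then R 4 else 0)"
  have "effect (check_pairs (p # ps)) (R, M) = effect (check_pairs ps) (R', M)"
    by (auto simp: p R'_def y_def fun_upd_twist)
  moreover obtain x where "effect (check_pairs ps) (R', M) =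
     (R'(4 := if \<forall>(i, j)\<in>set ps. M (R' (11 + 2 * i) + R' (10 + 2 * j)) \<noteq> 0 then R' 4 else 0, 5 := x), M)"
    using Cons.IH[of R'] by blast
  moreover have "R' (11 + 2 * i) = R (11 + 2 * i)" "R' (10 + 2 * i) = R (10 + 2 * i)" for i
    by (auto simp: R'_def)
  ultimately show ?case
    by (auto simp: p R'_def y_def fun_eq_iff intro!: exI[of _ x])
qed

definition adjacent_tuple :: "nat \<Rightarrow> nat set set \<Rightarrow> (nat \<Rightarrow> nat) \<Rightarrow> bool" where
  "adjacent_tuple t E xs \<longleftrightarrow> (\<forall>i j. i < j \<and> j < t \<longrightarrow> {xs i, xs j} \<in> E)"

definition tuple_state :: "nat \<Rightarrow> nat \<Rightarrow> nat set set \<Rightarrow> nat \<Rightarrow> (nat \<Rightarrow> nat) \<Rightarrow> state \<Rightarrow> bool" where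
  "tuple_state t n E k ys z \<longleftrightarrow>
     fst z 0 = n \<and> fst z 1 = 1 \<and> fst z 2 = n * n \<and> snd z = adj_matrix n E \<and>
     (\<forall>j. k \<le> j \<and> j < t \<longrightarrow> ys j < n \<and> fst z (10 + 2 * j) = ys j \<and> fst z (11 + 2 * j) = ys j * n)"

text \<open>Generalised over \<open>ys\<close>, the choices made by the enclosing loops, and over
  \<open>f\<close>, the outcome for the tuples examined before: both change from round to round.
  Level \<open>k\<close> fills the positions below \<open>k\<close>.\<close>

lemma run_tuples:
  assumes "k \<le> t" "tuple_state t n E k ys z" "fst z 3 = of_bool f"
  shows "run (tuples k (check_tuple t)) z ((5 * (n + 1)) ^ k * cost (check_tuple t))
     (\<lambda>z'. tuple_state t n E k ys z' \<and>
       fst z' 3 = of_bool (f \<or> (\<exists>xs. (\<forall>j<k. xs j < n) \<and> (\<forall>j\<ge>k. xs j = ys j) \<and> adjacent_tuple t E xs)))"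
  using assms
proof (induction k arbitrary: ys z f)
  case 0
  obtain R M where z: "z = (R, M)" by force
  have entry: "M (R (11 + 2 * i) + R (10 + 2 * j)) \<noteq> 0 \<longleftrightarrow> {ys i, ys j} \<in> E" if "i < j" "j < t" for i j
    using 0(2) that by (simp add: tuple_state_def z adj_matrix_entry)
  obtain x where x: "effect (check_pairs (pairs t)) (R(4 := 1), M) =
     ((R(4 := 1))(4 := if \<forall>(i, j)\<in>set (pairs t). M ((R(4 := 1)) (11 + 2 * i) + (R(4 := 1)) (10 + 2 * j)) \<noteq> 0
        then (R(4 := 1)) 4 else 0, 5 := x), M)"
    using effect_check_pairs[of "pairs t" "R(4 := 1)" M] by blast
  have "(\<forall>(i, j)\<in>set (pairs t). M ((R(4 := 1)) (11 + 2 * i) + (R(4 := 1)) (10 + 2 * j)) \<noteq> 0) \<longleftrightarrow>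
      adjacent_tuple t E ys"
    using entry by (auto simp: pairs_def adjacent_tuple_def)
  with x have e: "effect (check_tuple t) z =
      (R(4 := of_bool (adjacent_tuple t E ys), 5 := x, 3 := of_bool (f \<or> adjacent_tuple t E ys)), M)"
    using 0(3) by (auto simp: check_tuple_def z fun_eq_iff)
  let ?Q = "\<lambda>z'. tuple_state t n E 0 ys z' \<and>
     fst z' 3 = of_bool (f \<or> (\<exists>xs. (\<forall>j<0. xs j < n) \<and> (\<forall>j\<ge>0. xs j = ys j) \<and> adjacent_tuple t E xs))"
  have "(\<forall>j\<ge>0. xs j = ys j) \<longleftrightarrow> xs = ys" for xs
    by auto
  then have "?Q (effect (check_tuple t) z)"
    unfolding e using 0(2) by (simp add: z tuple_state_def)
  then show ?case
    by (intro run_straight_le) simp_all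
next
  case (Suc k)
  define T where "T = (5 * (n + 1)) ^ k * cost (check_tuple t)"
  have "cost (check_tuple t) \<ge> 1"
    by (simp add: check_tuple_def)
  then have T: "T \<ge> 1"
    by (simp add: T_def)
  obtain R M where z: "z = (R, M)" by force
  define x b where "x = 10 + 2 * k" and "b = 11 + 2 * k"
  have xb: "x \<ge> 10" "b \<ge> 10" "x \<noteq> b" "b \<noteq> x" "x = 10 + 2 * k" "b = 11 + 2 * k"
    "10 + 2 * j = x \<longleftrightarrow> j = k" "11 + 2 * j = b \<longleftrightarrow> j = k" "10 + 2 * j \<noteq> b" "11 + 2 * j \<noteq> x" for j
    unfolding x_def b_def by presburger+
  \<comment> \<open>The result once all entries at least \<open>m\<close> have been tried in
    position \<open>k\<close>: no tuple is added for \<open>m = n\<close>, and \<open>m = 0\<close>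
    covers them all.\<close>
  define found where "found m \<longleftrightarrow> f \<or> (\<exists>xs. (\<forall>j<k. xs j < n) \<and> m \<le> xs k \<and> xs k < n \<and>
      (\<forall>j\<ge>Suc k. xs j = ys j) \<and> adjacent_tuple t E xs)" for m
  define I where "I m z' \<longleftrightarrow> tuple_state t n E (Suc k) ys z' \<and> fst z' x = m \<and> fst z' b = m * n \<and> m \<le> n \<and>
      fst z' 3 = of_bool (found m)" for m z'
  have step: "run ((Sub x x 1 ;; Sub b b 0) ;; tuples k (check_tuple t)) z1 (T + 2) (I m)"
    if I: "I (Suc m) z1" for m z1
  proof -
    obtain R1 M1 where z1: "z1 = (R1, M1)" by force
    define z2 where "z2 = (R1(x := m, b := m * n), M1)"
    have ts: "tuple_state t n E k (ys(k := m)) z2"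
      unfolding tuple_state_def
    proof (intro conjI allI impI)
      fix j assume j: "k \<le> j \<and> j < t"
      have "Suc k \<le> j" if "j \<noteq> k" using that j by auto
      then show "(ys(k := m)) j < n" "fst z2 (10 + 2 * j) = (ys(k := m)) j"
          "fst z2 (11 + 2 * j) = (ys(k := m)) j * n"
        using I j by (auto simp: I_def z1 z2_def tuple_state_def xb(1-4,7-))
    qed (use I in \<open>auto simp: I_def z1 z2_def tuple_state_def x_def b_def\<close>)
    have "run (tuples k (check_tuple t)) z2 T (\<lambda>z'. tuple_state t n E k (ys(k := m)) z' \<and>
       fst z' 3 = of_bool (found (Suc m) \<or> (\<exists>xs. (\<forall>j<k. xs j < n) \<and> (\<forall>j\<ge>k. xs j = (ys(k := m)) j) \<and>
         adjacent_tuple t E xs)))"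
      unfolding T_def by (rule Suc.IH[OF _ ts]) (use Suc.prems I xb in \<open>auto simp: I_def z1 z2_def\<close>)
    moreover have "found (Suc m) \<or> (\<exists>xs. (\<forall>j<k. xs j < n) \<and> (\<forall>j\<ge>k. xs j = (ys(k := m)) j) \<and>
         adjacent_tuple t E xs) \<longleftrightarrow> found m"
    proof -
      define W where "W xs \<longleftrightarrow> (\<forall>j<k. xs j < n) \<and> (\<forall>j\<ge>Suc k. xs j = ys j) \<and> adjacent_tuple t E xs" for xs
      have fnd: "found l \<longleftrightarrow> f \<or> (\<exists>xs. W xs \<and> l \<le> xs k \<and> xs k < n)" for l
        unfolding found_def W_def by blast
      have "(\<forall>j\<ge>k. xs j = (ys(k := m)) j) \<longleftrightarrow> xs k = m \<and> (\<forall>j\<ge>Suc k. xs j = ys j)" for xs :: "nat \<Rightarrow> nat"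
      proof
        assume *: "\<forall>j\<ge>k. xs j = (ys(k := m)) j"
        show "xs k = m \<and> (\<forall>j\<ge>Suc k. xs j = ys j)"
        proof (intro conjI allI impI)
          show "xs k = m" using * by simp
          show "xs j = ys j" if "Suc k \<le> j" for j
            using *[rule_format, of j] that by simp
        qed
      next
        assume *: "xs k = m \<and> (\<forall>j\<ge>Suc k. xs j = ys j)"
        show "\<forall>j\<ge>k. xs j = (ys(k := m)) j"
        proof (intro allI impI)
          show "xs j = (ys(k := m)) j" if "k \<le> j" for j
            using * that by (cases "j = k") auto
        qed
      qed
      then have new: "(\<exists>xs. (\<forall>j<k. xs j < n) \<and> (\<forall>j\<ge>k. xs j = (ys(k := m)) j) \<and> adjacent_tuple t E xs) \<longleftrightarrow>
          (\<exists>xs. W xs \<and> xs k = m)"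
        unfolding W_def by (simp only:) blast
      have "m < n" using I by (auto simp: I_def)
      then have "(\<exists>xs. W xs \<and> m \<le> xs k \<and> xs k < n) \<longleftrightarrow>
          (\<exists>xs. W xs \<and> Suc m \<le> xs k \<and> xs k < n) \<or> (\<exists>xs. W xs \<and> xs k = m)"
        using le_eq_less_or_eq Suc_le_eq by (metis less_or_eq_imp_le)
      then show ?thesis
        unfolding new fnd by blast
    qed
    moreover have "tuple_state t n E (Suc k) ys z' \<and> fst z' x = m \<and> fst z' b = m * n"
      if ts': "tuple_state t n E k (ys(k := m)) z'" for z'
    proof -
      have regs: "(ys(k := m)) j < n \<and> fst z' (10 + 2 * j) = (ys(k := m)) j \<and>
          fst z' (11 + 2 * j) = (ys(k := m)) j * n" if "k \<le> j" "j < t" for j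
        using ts' that unfolding tuple_state_def by blast
      have "ys j < n \<and> fst z' (10 + 2 * j) = ys j \<and> fst z' (11 + 2 * j) = ys j * n"
        if "Suc k \<le> j" "j < t" for j
        using regs[of j] that by simp
      then have "tuple_state t n E (Suc k) ys z'"
        using ts' unfolding tuple_state_def by blast
      then show ?thesis
        using regs[of k] Suc.prems(1) by (simp add: x_def b_def)
    qed
    moreover have "m \<le> n" using I by (auto simp: I_def)
    ultimately have "run (tuples k (check_tuple t)) z2 T (I m)"
      by (elim run_mono) (auto simp: I_def)
    then show ?thesis
      by (rule run_straight_then) (use I xb in \<open>auto simp: I_def z1 z2_def tuple_state_def\<close>)
  qed
  define z1 where "z1 = (R(x := n, b := n * n), M)"
  have "I n z1"
    unfolding I_def tuple_state_def
  proof (intro conjI allI impI)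
    fix j assume "Suc k \<le> j \<and> j < t"
    then show "ys j < n" "fst z1 (10 + 2 * j) = ys j" "fst z1 (11 + 2 * j) = ys j * n"
      using Suc.prems(2) by (auto simp: z z1_def tuple_state_def xb(1-4,7-))
  qed (use Suc.prems in \<open>auto simp: z z1_def tuple_state_def x_def b_def found_def\<close>)
  then have "run (WhileNZ x ((Sub x x 1 ;; Sub b b 0) ;; tuples k (check_tuple t))) z1
      (n * (T + 2 + 1) + 1) (I 0)"
    by (rule run_WhileNZ[where I = I, rotated -1]) (use step in \<open>auto simp: I_def\<close>)
  then have "run (tuples (Suc k) (check_tuple t)) z (n * (T + 2 + 1) + 3) (I 0)"
    unfolding tuples.simps xb(5,6)[symmetric]
    by (rule run_straight_then) (use Suc.prems xb in \<open>auto simp: z z1_def tuple_state_def\<close>)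
  moreover have "n * (T + 2 + 1) + 3 \<le> (5 * (n + 1)) ^ Suc k * cost (check_tuple t)"
  proof -
    have "n * (T + 2 + 1) + 3 \<le> (n + 1) * T + 3 * ((n + 1) * T)"
      using T mult_le_mono2[OF T, of n] by (simp only: distrib_right distrib_left)
    also have "\<dots> \<le> 5 * ((n + 1) * T)" by simp
    finally show ?thesis
      by (simp add: T_def algebra_simps)
  qed
  moreover have "found 0 \<longleftrightarrow> f \<or> (\<exists>xs. (\<forall>j<Suc k. xs j < n) \<and> (\<forall>j\<ge>Suc k. xs j = ys j) \<and> adjacent_tuple t E xs)"
    unfolding found_def by (auto simp: less_Suc_eq)
  ultimately show ?case
    by (elim run_mono) (auto simp: I_def)
qed

text \<open>Edges have two elements, so pairwise adjacent entries are automatically distinct and the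
  enumeration need not exclude repetitions. The value 0 beyond \<open>t\<close> fixes a
  representative that matches the initial \<open>ys\<close> of \<open>run_tuples\<close>.\<close>

lemma ex_adjacent_tuple_iff:
  assumes "E \<subseteq> nsets {..<n} 2"
  shows "(\<exists>xs. (\<forall>j<t. xs j < n) \<and> (\<forall>j\<ge>t. xs j = 0) \<and> adjacent_tuple t E xs) \<longleftrightarrow>
     \<not> complete_free t ({..<n}, E)"
proof
  assume "\<exists>xs. (\<forall>j<t. xs j < n) \<and> (\<forall>j\<ge>t. xs j = 0) \<and> adjacent_tuple t E xs"
  then obtain xs where xs: "\<forall>j<t. xs j < n" "adjacent_tuple t E xs" by blast
  have ne: "xs i \<noteq> xs j" and ed: "{xs i, xs j} \<in> E" if "i < j" "j < t" for i j
  proof -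
    show "{xs i, xs j} \<in> E"
      using xs(2) that by (auto simp: adjacent_tuple_def)
    then show "xs i \<noteq> xs j"
      using assms by (auto simp: nsets_def)
  qed
  have "inj_on xs {..<t}"
    by (rule linorder_inj_onI) (use ne in auto)
  then have "card (xs ` {..<t}) = t"
    by (simp add: card_image)
  moreover have "clique (xs ` {..<t}) E"
    unfolding clique_def
  proof (intro ballI impI)
    fix v w assume "v \<in> xs ` {..<t}" "w \<in> xs ` {..<t}" "v \<noteq> w"
    then obtain i j where "i < t" "j < t" "v = xs i" "w = xs j" "i \<noteq> j" by auto
    then show "{v, w} \<in> E"
      using ed[of i j] ed[of j i] by (cases "i < j") (auto simp: insert_commute)
  qed
  ultimately show "\<not> complete_free t ({..<n}, E)"
    using xs(1) unfolding complete_free_def by auto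
next
  assume "\<not> complete_free t ({..<n}, E)"
  then obtain K where K: "K \<subseteq> {..<n}" "card K = t" "clique K E"
    unfolding complete_free_def by auto
  then have "finite K" using finite_subset by blast
  then obtain h where h: "bij_betw h {0..<t} K"
    using ex_bij_betw_nat_finite K(2) by blast
  define xs where "xs j = (if j < t then h j else 0)" for j
  have "h j \<in> K" if "j < t" for j
    using h that by (auto simp: bij_betw_def)
  moreover have "h i \<noteq> h j" if "i < j" "j < t" for i j
    using inj_on_eq_iff[OF bij_betw_imp_inj_on[OF h], of i j] that by simp
  ultimately have "(\<forall>j<t. xs j < n) \<and> (\<forall>j\<ge>t. xs j = 0) \<and> adjacent_tuple t E xs"
    using K(1,3) by (auto simp: xs_def adjacent_tuple_def clique_def)
  then show "\<exists>xs. (\<forall>j<t. xs j < n) \<and> (\<forall>j\<ge>t. xs j = 0) \<and> adjacent_tuple t E xs" by blast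
qed

lemma decides_clique_checker:
  "decides_within (clique_checker t) (complete_free t)
     (\<lambda>n. 3 * n + 5 + (5 * (n + 1)) ^ t * cost (check_tuple t))"
  unfolding decides_within_def
proof (intro allI impI)
  fix n and E :: "nat set set" assume G: "simple_graph ({..<n}, E)"
  define R :: "nat \<Rightarrow> nat" where "R = (\<lambda>r. if r = 0 then n else 0)"
  define M where "M = adj_matrix n E"
  have s: "input_state n E = (R, M)"
    by (auto simp: input_state_def R_def M_def adj_matrix_def fun_eq_iff)
  define z where "z = (R(1 := 1, 2 := n * n, 6 := 0), M)"
  define T where "T = (5 * (n + 1)) ^ t * cost (check_tuple t)"
  let ?found = "\<exists>xs. (\<forall>j<t. xs j < n) \<and> (\<forall>j\<ge>t. xs j = 0) \<and> adjacent_tuple t E xs"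
  let ?Q = "\<lambda>z. fst z 0 = (if complete_free t ({..<n}, E) then 1 else 0)"
  have "tuple_state t n E t (\<lambda>_. 0) z" "fst z 3 = of_bool False"
    by (auto simp: tuple_state_def z_def R_def M_def)
  from run_tuples[OF order.refl this] have
    "run (tuples t (check_tuple t)) z T (\<lambda>z. fst z 1 = 1 \<and> fst z 3 = of_bool ?found)"
    unfolding T_def by (rule run_mono) (auto simp: tuple_state_def)
  moreover have "?found \<longleftrightarrow> \<not> complete_free t ({..<n}, E)"
    by (rule ex_adjacent_tuple_iff) (use G in \<open>simp add: simple_graph_def\<close>)
  ultimately have "run (tuples t (check_tuple t)) z T (\<lambda>z. ?Q (effect (Sub 0 1 3) z))"
    by (elim run_mono) auto
  from run_Seq_straight[OF this] have "run (tuples t (check_tuple t) ;; Sub 0 1 3) z (T + 1) ?Q"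
    by simp
  then have "run (mul_prog 1 2 0 0 6 ;; tuples t (check_tuple t) ;; Sub 0 1 3) (R(1 := 1), M) (3 * n + 4 + T) ?Q"
    by (rule run_mul_then) (auto simp: R_def z_def)
  then have "run (clique_checker t) (input_state n E) (3 * n + 5 + T) ?Q"
    unfolding clique_checker_def s by (rule run_straight_then) auto
  then show "\<exists>k s. exec (clique_checker t) (input_state n E) k s \<and>
      k \<le> 3 * n + 5 + (5 * (n + 1)) ^ t * cost (check_tuple t) \<and> ?Q s"
    unfolding run_def T_def by blast
qed

section \<open>Ramsey bound and total running time\<close>

text \<open>Ramsey's theorem makes the \<open>LEAST\<close> well defined. An arbitrary
  \<open>E\<close> is first cut down to the pairs in \<open>V\<close>, because the Ramsey number
  speaks of simple graphs; homogeneous subsets of \<open>V\<close> are not affected.\<close>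

lemma ramsey_number_works:
  fixes V :: "nat set"
  assumes "finite V" "ramsey_number p q \<le> card V"
  shows "(\<exists>K\<subseteq>V. card K = p \<and> clique K E) \<or> (\<exists>I\<subseteq>V. card I = q \<and> indep I E)"
proof -
  define good where "good n \<longleftrightarrow> (\<forall>(V :: nat set) E. simple_graph (V, E) \<and> n \<le> card V \<longrightarrow>
     (\<exists>K\<subseteq>V. card K = p \<and> clique K E) \<or> (\<exists>I\<subseteq>V. card I = q \<and> indep I E))" for n
  obtain r where r: "\<forall>(V :: nat set) (E :: nat set set). finite V \<and> card V \<ge> r \<longrightarrow>
      (\<exists>R \<subseteq> V. card R = p \<and> clique R E \<or> card R = q \<and> indep R E)"
    using ramsey2[of p q] by blast
  have "good r"
    unfolding good_def
  proof (intro allI impI)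
    fix V :: "nat set" and E
    assume "simple_graph (V, E) \<and> r \<le> card V"
    then show "(\<exists>K\<subseteq>V. card K = p \<and> clique K E) \<or> (\<exists>I\<subseteq>V. card I = q \<and> indep I E)"
      using r[rule_format, of V E] unfolding simple_graph_def by auto
  qed
  then have "good (ramsey_number p q)"
    unfolding ramsey_number_def good_def[symmetric] by (rule LeastI)
  moreover have "simple_graph (V, E \<inter> nsets V 2)"
    using assms(1) by (simp add: simple_graph_def)
  ultimately have "(\<exists>K\<subseteq>V. card K = p \<and> clique K (E \<inter> nsets V 2)) \<or>
      (\<exists>I\<subseteq>V. card I = q \<and> indep I (E \<inter> nsets V 2))"
    using assms(2) unfolding good_def by blast
  moreover have "clique K E" if "clique K (E \<inter> nsets V 2)" for K
    using that by (auto simp: clique_def)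
  moreover have "indep I E" if "I \<subseteq> V" "indep I (E \<inter> nsets V 2)" for I
    unfolding indep_def
  proof (intro ballI impI)
    fix v w assume vw: "v \<in> I" "w \<in> I" "v \<noteq> w"
    then have "{v, w} \<in> nsets V 2"
      using that(1) by (auto simp: nsets_def)
    then show "{v, w} \<notin> E"
      using that(2) vw unfolding indep_def by blast
  qed
  ultimately show ?thesis by blast
qed

text \<open>A homogeneous set of size \<open>t\<close> has to fit into any vertex set of size
  \<open>ramsey_number t t\<close>. This absorbs the cost of the clique checker into the final
  exponent.\<close>

lemma ramsey_number_ge: "t \<le> ramsey_number t t"
proof -
  have "card K \<le> ramsey_number t t" if "K \<subseteq> {..<ramsey_number t t}" for K
    using card_mono[OF _ that] by simp
  then show ?thesis
    using ramsey_number_works[of "{..<ramsey_number t t}" t t "{}"] by auto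
qed

section \<open>Solutions differ in few vertices\<close>

lemma complement_edgeI:
  "u < i \<Longrightarrow> v < i \<Longrightarrow> u \<noteq> v \<Longrightarrow> ({u, v} \<in> E) \<noteq> (u \<in> S \<and> v \<in> S) \<Longrightarrow>
     {u, v} \<in> snd (subgraph_complement ({..<i}, E) S)"
  unfolding subgraph_complement_def by auto

text \<open>The full \<open>E\<close> is kept at every stage: complementation reads only pairs
  inside the vertex set, so the edge sets of the stages are nested.\<close>

lemma complete_free_mono:
  fixes i n :: nat
  assumes "complete_free t (subgraph_complement ({..<n}, E) S)" "i \<le> n"
  shows "complete_free t (subgraph_complement ({..<i}, E) S)"
proof -
  have "snd (subgraph_complement ({..<i}, E) S) \<subseteq> snd (subgraph_complement ({..<n}, E) S)"
  proof
    fix e assume "e \<in> snd (subgraph_complement ({..<i}, E) S)"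
    then obtain u v where e: "e = {u, v}" and uv: "u < i" "v < i" "u \<noteq> v" "({u, v} \<in> E) \<noteq> (u \<in> S \<and> v \<in> S)"
      unfolding subgraph_complement_def by auto
    show "e \<in> snd (subgraph_complement ({..<n}, E) S)"
      unfolding e by (rule complement_edgeI) (use uv assms(2) in auto)
  qed
  then have 1: "clique K (snd (subgraph_complement ({..<n}, E) S))"
    if "clique K (snd (subgraph_complement ({..<i}, E) S))" for K
    using that unfolding clique_def by blast
  have 2: "K \<subseteq> {..<n}" if "K \<subseteq> {..<i}" for K
    using that assms(2) by auto
  have iff: "complete_free t (subgraph_complement ({..<j}, E) S) \<longleftrightarrow>
      \<not> (\<exists>K\<subseteq>{..<j}. card K = t \<and> clique K (snd (subgraph_complement ({..<j}, E) S)))" for j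
    by (simp add: complete_free_def subgraph_complement_def)
  show ?thesis
    unfolding iff
  proof
    assume "\<exists>K\<subseteq>{..<i}. card K = t \<and> clique K (snd (subgraph_complement ({..<i}, E) S))"
    then obtain K where "K \<subseteq> {..<i}" "card K = t" "clique K (snd (subgraph_complement ({..<i}, E) S))"
      by (elim exE conjE)
    then show False
      using assms(1) 1[of K] 2[of K] unfolding iff by (elim notE) (intro exI[of _ K] conjI)
  qed
qed

lemma subgraph_complement_cong:
  assumes "\<And>x. x < i \<Longrightarrow> x \<in> S \<longleftrightarrow> x \<in> X"
  shows "subgraph_complement ({..<i}, E) S = subgraph_complement ({..<i}, E) X"
proof -
  have "(u \<in> {..<i} \<and> v \<in> {..<i} \<and> u \<noteq> v \<and>
           ({u, v} \<in> E \<and> (u \<notin> S \<or> v \<notin> S) \<or> {u, v} \<notin> E \<and> u \<in> S \<and> v \<in> S)) \<longleftrightarrow>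
        (u \<in> {..<i} \<and> v \<in> {..<i} \<and> u \<noteq> v \<and>
           ({u, v} \<in> E \<and> (u \<notin> X \<or> v \<notin> X) \<or> {u, v} \<notin> E \<and> u \<in> X \<and> v \<in> X))" for u v
    using assms[of u] assms[of v] by blast
  then show ?thesis
    unfolding subgraph_complement_def by (simp only: prod.case)
qed

lemma card_diff_lt_ramsey:
  fixes S X :: "nat set"
  assumes S: "complete_free t (subgraph_complement ({..<i}, E) S)"
    and X: "complete_free t (subgraph_complement ({..<i}, E) X)"
  shows "card {x. x < i \<and> x \<in> S \<and> x \<notin> X} < ramsey_number t t"
proof (rule ccontr)
  define V where "V = {x. x < i \<and> x \<in> S \<and> x \<notin> X}"
  assume "\<not> card {x. x < i \<and> x \<in> S \<and> x \<notin> X} < ramsey_number t t"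
  then have "ramsey_number t t \<le> card V" by (simp add: V_def)
  moreover have "finite V" by (simp add: V_def)
  ultimately consider K where "K \<subseteq> V" "card K = t" "clique K E" | I where "I \<subseteq> V" "card I = t" "indep I E"
    using ramsey_number_works[of V t t E] by blast
  then show False
  proof cases
    case (1 K)
    have "clique K (snd (subgraph_complement ({..<i}, E) X))"
      unfolding clique_def
      by (intro ballI impI complement_edgeI) (use 1 in \<open>auto simp: V_def clique_def\<close>)
    moreover have "K \<subseteq> {..<i}" using 1(1) by (auto simp: V_def)
    ultimately show False
      using X 1(2) by (auto simp: complete_free_def subgraph_complement_def)
  next
    case (2 I)
    have "clique I (snd (subgraph_complement ({..<i}, E) S))"
      unfolding clique_def
      by (intro ballI impI complement_edgeI) (use 2 in \<open>auto simp: V_def indep_def\<close>)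
    moreover have "I \<subseteq> {..<i}" using 2(1) by (auto simp: V_def)
    ultimately show False
      using S 2(2) by (auto simp: complete_free_def subgraph_complement_def)
  qed
qed

text \<open>Each one-sided difference is strictly below the Ramsey number, hence the slack of 2;
  part of it pays for the next vertex in \<open>near_complete_free\<close>.\<close>

lemma card_symdiff_le_ramsey:
  fixes S X :: "nat set"
  assumes "complete_free t (subgraph_complement ({..<i}, E) S)"
    and "complete_free t (subgraph_complement ({..<i}, E) X)"
  shows "card {x. x < i \<and> (x \<in> S) \<noteq> (x \<in> X)} + 2 \<le> 2 * ramsey_number t t"
proof -
  have "{x. x < i \<and> (x \<in> S) \<noteq> (x \<in> X)} =
      {x. x < i \<and> x \<in> S \<and> x \<notin> X} \<union> {x. x < i \<and> x \<in> X \<and> x \<notin> S}" by auto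
  then have "card {x. x < i \<and> (x \<in> S) \<noteq> (x \<in> X)} \<le>
      card {x. x < i \<and> x \<in> S \<and> x \<notin> X} + card {x. x < i \<and> x \<in> X \<and> x \<notin> S}"
    by (simp add: card_Un_le)
  then show ?thesis
    using card_diff_lt_ramsey[OF assms] card_diff_lt_ramsey[OF assms(2,1)] by linarith
qed

text \<open>Nothing is known about membership of the new vertex \<open>i\<close> in
  \<open>S\<close>, so it may add one disagreement to those below \<open>i\<close>.\<close>

lemma near_complete_free:
  assumes S: "complete_free t (subgraph_complement ({..<i}, E) S)"
    and X: "complete_free t (subgraph_complement ({..<Suc i}, E) X)"
  obtains Y where "Y \<in> near (Suc i) (2 * ramsey_number t t) S"
    "subgraph_complement ({..<Suc i}, E) Y = subgraph_complement ({..<Suc i}, E) X"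
proof -
  have "{x. x < Suc i \<and> (x \<in> S) \<noteq> (x \<in> X)} \<subseteq> insert i {x. x < i \<and> (x \<in> S) \<noteq> (x \<in> X)}"
    by (auto simp: less_Suc_eq)
  then have "card {x. x < Suc i \<and> (x \<in> S) \<noteq> (x \<in> X)} \<le> card (insert i {x. x < i \<and> (x \<in> S) \<noteq> (x \<in> X)})"
    by (intro card_mono) auto
  also have "\<dots> \<le> card {x. x < i \<and> (x \<in> S) \<noteq> (x \<in> X)} + 1"
    by (subst card_insert_if) auto
  also have "\<dots> \<le> 2 * ramsey_number t t"
    using card_symdiff_le_ramsey[OF S complete_free_mono[OF X]] by simp
  finally obtain Y where "Y \<in> near (Suc i) (2 * ramsey_number t t) S" "\<forall>x<Suc i. x \<in> Y \<longleftrightarrow> x \<in> X"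
    using near_covers by blast
  then show ?thesis
    using that subgraph_complement_cong[of "Suc i" Y X E] by blast
qed

text \<open>The search may leave sets that contain a dummy index; cutting them down to the vertex
  set does not change the complement.\<close>

lemma subgraph_complement_to_iff:
  "subgraph_complement_to \<G> ({..<n}, E) \<longleftrightarrow> (\<exists>X. subgraph_complement ({..<n}, E) X \<in> \<G>)"
proof -
  have "subgraph_complement ({..<n}, E) X = subgraph_complement ({..<n}, E) (X \<inter> {..<n})" for X
    by (rule subgraph_complement_cong) auto
  then show ?thesis
    unfolding subgraph_complement_to_def by (metis fst_conv inf_le2)
qed

text \<open>Every execution takes at least one time unit. This allows costs without the factor
  \<open>T n\<close> to be bounded by multiples of it.\<close>

lemma decides_within_ge_1:
  assumes "decides_within c P T"
  shows "T n \<ge> 1"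
proof -
  have "simple_graph ({..<n}, {})" by (simp add: simple_graph_def)
  then obtain k s where "exec c (input_state n {}) k s" "k \<le> T n"
    using assms unfolding decides_within_def by blast
  then show ?thesis using exec_time_pos by fastforce
qed

lemma poly_bigo: "(\<lambda>n. poly p (real n)) \<in> O(\<lambda>n. real n ^ degree p)"
proof -
  have "(\<lambda>n. coeff p i * real n ^ i) \<in> O(\<lambda>n. real n ^ degree p)" if "i \<le> degree p" for i
  proof (rule bigoI[of _ "\<bar>coeff p i\<bar>"], rule eventually_mono[OF eventually_ge_at_top[of 1]])
    fix n :: nat assume "n \<ge> 1"
    then have "real n ^ i \<le> real n ^ degree p" using that by (intro power_increasing) auto
    then show "norm (coeff p i * real n ^ i) \<le> \<bar>coeff p i\<bar> * norm (real n ^ degree p)"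
      by (simp add: abs_mult mult_left_mono)
  qed
  then show ?thesis
    unfolding poly_altdef by (intro big_sum_in_bigo) auto
qed

text \<open>The exact bounds use powers of \<open>n + 1\<close>, which stay positive at
  \<open>n = 0\<close>; from \<open>n = 1\<close> on, \<open>n + 1\<close> is at most
  \<open>2 * n\<close>.\<close>

lemma suc_power_bigo: "(\<lambda>n. real (n + 1) ^ e) \<in> O(\<lambda>n. real n ^ e)"
proof (rule bigoI[of _ "2 ^ e"], rule eventually_mono[OF eventually_ge_at_top[of 1]])
  fix n :: nat assume "n \<ge> 1"
  then have "real (n + 1) ^ e \<le> (2 * real n) ^ e" by (intro power_mono) auto
  then show "norm (real (n + 1) ^ e) \<le> 2 ^ e * norm (real n ^ e)"
    by (simp add: power_mult_distrib)
qed

text \<open>Since \<open>t \<le> R\<close>, a clique trial costs at most a constant times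
  \<open>(n + 1) ^ (R + 2)\<close>; with \<open>n\<close> rounds of searches over
  \<open>2 * R\<close> flips the growing phase has exponent \<open>3 * R + 3\<close>. The final
  phase has exponent \<open>2 * R + 2\<close> beside \<open>T2 n\<close>. The constants are 118 = 50
  + 8 * 8 + 4 and 62 = 50 + 8 + 4.\<close>

lemma main_time_bound:
  fixes T2 :: "nat \<Rightarrow> nat" and R t D N n :: nat
  defines "T1 \<equiv> \<lambda>n. 3 * n + 5 + (5 * (n + 1)) ^ t * D"
  defines "\<tau> \<equiv> \<lambda>T. 50 * (n + 1)\<^sup>2 + 8 * T n + N + 4"
  assumes t: "1 \<le> t" "t \<le> R" and T2: "T2 n \<ge> 1"
  shows "3 * n + 11 + n * ((20 * (n + 1)) ^ (2 * R) * \<tau> T1 + 4) + (20 * (n + 1)) ^ (2 * R) * \<tau> T2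
    \<le> (15 + 20 ^ (2 * R) * (118 + N + 8 * 5 ^ t * D) + 20 ^ (2 * R) * (62 + N)) *
        T2 n * (n + 1) ^ (8 * R + 4)"
proof -
  define m where "m = n + 1"
  have m: "m \<ge> 1" by (simp add: m_def)
  define M where "M = m ^ (8 * R + 4)"
  have pow: "m ^ a \<le> M" if "a \<le> 8 * R + 4" for a
    unfolding M_def using m that by (intro power_increasing) auto
  have pow': "m ^ (R + 2) \<ge> m ^ a" if "a \<le> R + 2" for a
    using m that by (intro power_increasing) auto
  have p: "m\<^sup>2 \<le> m ^ (R + 2)" "m ^ t \<le> m ^ (R + 2)" "m \<le> m ^ (R + 2)" "1 \<le> m ^ (R + 2)"
    using pow'[of 2] pow'[of t] pow'[of 1] pow'[of 0] t by auto
  have 1: "3 * n + 11 + n * 4 \<le> 15 * M"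
    using pow[of 1] pow[of 0] by (simp add: m_def)
  have "n \<le> m" by (simp add: m_def)
  then have "T1 n \<le> 3 * m + 5 + 5 ^ t * D * m ^ t"
    unfolding T1_def m_def[symmetric] power_mult_distrib by (simp add: ac_simps)
  also have "\<dots> \<le> 3 * m ^ (R + 2) + 5 * m ^ (R + 2) + 5 ^ t * D * m ^ (R + 2)"
    using p by (intro add_mono mult_left_mono) auto
  finally have "T1 n \<le> (8 + 5 ^ t * D) * m ^ (R + 2)"
    by (simp add: algebra_simps)
  then have "\<tau> T1 \<le> 50 * m ^ (R + 2) + 8 * ((8 + 5 ^ t * D) * m ^ (R + 2)) + N * m ^ (R + 2) + 4 * m ^ (R + 2)"
    unfolding \<tau>_def m_def[symmetric] using p by (intro add_mono mult_left_mono) auto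
  also have "\<dots> \<le> (118 + N + 8 * 5 ^ t * D) * m ^ (R + 2)"
    by (simp add: algebra_simps)
  finally have "n * ((20 * m) ^ (2 * R) * \<tau> T1) \<le>
      m * ((20 * m) ^ (2 * R) * ((118 + N + 8 * 5 ^ t * D) * m ^ (R + 2)))"
    by (intro mult_mono mult_left_mono) (auto simp: m_def)
  also have "\<dots> = 20 ^ (2 * R) * (118 + N + 8 * 5 ^ t * D) * m ^ (1 + 2 * R + (R + 2))"
    by (simp only: power_mult_distrib power_add power_one_right mult_ac)
  also have "\<dots> \<le> 20 ^ (2 * R) * (118 + N + 8 * 5 ^ t * D) * M"
    by (intro mult_left_mono pow) auto
  finally have 2: "n * ((20 * m) ^ (2 * R) * \<tau> T1) \<le> 20 ^ (2 * R) * (118 + N + 8 * 5 ^ t * D) * M" .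
  have "1 \<le> m\<^sup>2 * T2 n" "m\<^sup>2 \<le> m\<^sup>2 * T2 n" "T2 n \<le> m\<^sup>2 * T2 n"
    using m T2 by auto
  then have "\<tau> T2 \<le> 50 * (m\<^sup>2 * T2 n) + 8 * (m\<^sup>2 * T2 n) + N * (m\<^sup>2 * T2 n) + 4 * (m\<^sup>2 * T2 n)"
    unfolding \<tau>_def m_def[symmetric] by (intro add_mono mult_left_mono) auto
  also have "\<dots> = (62 + N) * m\<^sup>2 * T2 n"
    by (simp add: algebra_simps)
  finally have "(20 * m) ^ (2 * R) * \<tau> T2 \<le> (20 * m) ^ (2 * R) * ((62 + N) * m\<^sup>2 * T2 n)"
    by (rule mult_left_mono) auto
  also have "\<dots> = 20 ^ (2 * R) * (62 + N) * T2 n * m ^ (2 * R + 2)"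
    by (simp only: power_mult_distrib power_add power_one_right mult_ac)
  also have "\<dots> \<le> 20 ^ (2 * R) * (62 + N) * T2 n * M"
    by (intro mult_left_mono pow) auto
  finally have 3: "(20 * m) ^ (2 * R) * \<tau> T2 \<le> 20 ^ (2 * R) * (62 + N) * T2 n * M" .
  have M: "a * M \<le> a * (T2 n * M)" for a
    using T2 by (intro mult_left_mono) auto
  have "3 * n + 11 + n * ((20 * m) ^ (2 * R) * \<tau> T1 + 4) + (20 * m) ^ (2 * R) * \<tau> T2
      = (3 * n + 11 + n * 4) + n * ((20 * m) ^ (2 * R) * \<tau> T1) + (20 * m) ^ (2 * R) * \<tau> T2"
    by (simp add: algebra_simps)
  also have "\<dots> \<le> 15 * (T2 n * M) + 20 ^ (2 * R) * (118 + N + 8 * 5 ^ t * D) * (T2 n * M) +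
      20 ^ (2 * R) * (62 + N) * T2 n * M"
    by (intro add_mono order.trans[OF 1 M] order.trans[OF 2 M] 3)
  finally show ?thesis
    unfolding m_def[symmetric] M_def[symmetric] by (simp add: algebra_simps)
qed

lemma solvable_in_time_mono:
  assumes "solvable_in_time P g" "g \<in> O(h)"
  shows "solvable_in_time P h"
  using assms landau_o.big_trans unfolding solvable_in_time_def by blast

text \<open>Stated for an arbitrary time function \<open>f\<close>, so that it applies directly both
  to a polynomial and to the bound \<open>n ^ t\<close> of the clique checker.\<close>

lemma solvable_subgraph_complement:
  assumes t: "t \<ge> 1" and G: "\<And>G. G \<in> \<G> \<Longrightarrow> complete_free t G"
    and f: "solvable_in_time (\<lambda>G. G \<in> \<G>) f"
  shows "solvable_in_time (subgraph_complement_to \<G>) (\<lambda>n. f n * real n ^ (8 * ramsey_number t t + 4))"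
proof -
  define R where "R = ramsey_number t t"
  obtain c2 T2 where c2: "decides_within c2 (\<lambda>G. G \<in> \<G>) T2" "(\<lambda>n. real (T2 n)) \<in> O(f)"
    using f unfolding solvable_in_time_def by blast
  define D where "D = cost (check_tuple t)"
  define T1 where "T1 = (\<lambda>n. 3 * n + 5 + (5 * (n + 1)) ^ t * D)"
  have c1: "decides_within (clique_checker t) (complete_free t) T1"
    unfolding T1_def D_def by (rule decides_clique_checker)
  have T1: "mono T1"
    unfolding T1_def by (intro monoI add_mono mult_mono power_mono) auto
  obtain N1 N2 where N12: "N1 \<ge> 1" "regs_below N1 (clique_checker t)" "regs_below N2 c2"
    using ex_regs_below by meson
  \<comment> \<open>One bank size that accommodates both programs.\<close>
  define N where "N = N1 + N2"
  have N: "N \<ge> 1" "regs_below N (clique_checker t)" "regs_below N c2"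
    using N12 by (auto simp: N_def intro: regs_below_mono)
  define T where "T n = 3 * n + 11 +
      n * ((20 * (n + 1)) ^ (2 * R) * (50 * (n + 1)\<^sup>2 + 8 * T1 n + N + 4) + 4) +
      (20 * (n + 1)) ^ (2 * R) * (50 * (n + 1)\<^sup>2 + 8 * T2 n + N + 4)" for n
  define C where "C = 15 + 20 ^ (2 * R) * (118 + N + 8 * 5 ^ t * D) + 20 ^ (2 * R) * (62 + N)"
  let ?c = "main_prog N (2 * R) (clique_checker t) c2"
  have "decides_within ?c (subgraph_complement_to \<G>) T"
    unfolding decides_within_def
  proof (intro allI impI)
    fix n and E :: "nat set set" assume "simple_graph ({..<n}, E)"
    then have E: "E \<subseteq> nsets {..<n} 2" by (simp add: simple_graph_def)
    have "run ?c (input_state n E) (T n)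
        (\<lambda>z. fst z 0 = of_bool (\<exists>X. subgraph_complement ({..<n}, E) X \<in> \<G>))"
      unfolding T_def
    proof (rule run_main_prog[OF E N c1 c2(1) T1])
      \<comment> \<open>Here \<open>t \<ge> 1\<close> matters: the empty set is a clique of size
        0.\<close>
      show "complete_free t (subgraph_complement ({..<0}, E) S)" for S
        using t by (auto simp: complete_free_def subgraph_complement_def)
    next
      fix i S X
      assume "i < n" and X: "subgraph_complement ({..<n}, E) X \<in> \<G>"
        and S: "complete_free t (subgraph_complement ({..<i}, E) S)"
      then have "complete_free t (subgraph_complement ({..<Suc i}, E) X)"
        using complete_free_mono[OF G[OF X]] by simp
      then show "\<exists>Y\<in>near (Suc i) (2 * R) S. complete_free t (subgraph_complement ({..<Suc i}, E) Y)"
        using near_complete_free[OF S] unfolding R_def by metis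
    next
      fix S X
      assume X: "subgraph_complement ({..<n}, E) X \<in> \<G>"
        and S: "complete_free t (subgraph_complement ({..<n}, E) S)"
      have "card {x. x < n \<and> (x \<in> S) \<noteq> (x \<in> X)} \<le> 2 * R"
        using card_symdiff_le_ramsey[OF S G[OF X]] by (simp add: R_def)
      then obtain Y where "Y \<in> near n (2 * R) S" "\<forall>x<n. x \<in> Y \<longleftrightarrow> x \<in> X"
        using near_covers by blast
      then show "\<exists>Y\<in>near n (2 * R) S. subgraph_complement ({..<n}, E) Y \<in> \<G>"
        using X subgraph_complement_cong[of n Y X E] by metis
    qed
    then show "\<exists>k s. exec ?c (input_state n E) k s \<and> k \<le> T n \<and>
        fst s 0 = (if subgraph_complement_to \<G> ({..<n}, E) then 1 else 0)"
      unfolding run_def subgraph_complement_to_iff of_bool_def .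
  qed
  moreover have "(\<lambda>n. real (T n)) \<in> O(\<lambda>n. f n * real n ^ (8 * R + 4))"
  proof -
    have "T n \<le> C * T2 n * (n + 1) ^ (8 * R + 4)" for n
      unfolding T_def C_def T1_def
      by (rule main_time_bound[OF t]) (use ramsey_number_ge decides_within_ge_1[OF c2(1)] in \<open>auto simp: R_def\<close>)
    then have "real (T n) \<le> real C * (real (T2 n) * real (n + 1) ^ (8 * R + 4))" for n
      by (metis of_nat_le_iff of_nat_mult of_nat_power mult.assoc)
    then have "(\<lambda>n. real (T n)) \<in> O(\<lambda>n. real (T2 n) * real (n + 1) ^ (8 * R + 4))"
      by (intro bigoI[of _ "real C"]) (simp add: abs_mult)
    also have "(\<lambda>n. real (T2 n) * real (n + 1) ^ (8 * R + 4)) \<in> O(\<lambda>n. f n * real n ^ (8 * R + 4))"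
      by (rule landau_o.big.mult[OF c2(2) suc_power_bigo])
    finally show ?thesis .
  qed
  ultimately show ?thesis
    unfolding solvable_in_time_def R_def by blast
qed

theorem theorem1:
  fixes t :: nat
  assumes "t \<ge> 1"
  shows "(\<forall>(\<G> :: nat graph set) (f :: real poly).
            (\<forall>G\<in>\<G>. simple_graph G \<and> complete_free t G) \<longrightarrow>
            solvable_in_time (\<lambda>G. G \<in> \<G>) (\<lambda>n. poly f (real n)) \<longrightarrow>
              solvable_in_polynomial_time (subgraph_complement_to \<G>) \<and>
              solvable_in_time (subgraph_complement_to \<G>)
                (\<lambda>n. poly f (real n) * real n ^ (8 * ramsey_number t t + 4))) \<and>
         solvable_in_time
           (subgraph_complement_to {G :: nat graph. simple_graph G \<and> complete_free t G})
           (\<lambda>n. real n ^ (8 * ramsey_number t t + t + 4))"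
proof (intro conjI allI impI)
  fix \<G> :: "nat graph set" and f :: "real poly"
  assume "\<forall>G\<in>\<G>. simple_graph G \<and> complete_free t G"
    and "solvable_in_time (\<lambda>G. G \<in> \<G>) (\<lambda>n. poly f (real n))"
  then show solvable: "solvable_in_time (subgraph_complement_to \<G>)
      (\<lambda>n. poly f (real n) * real n ^ (8 * ramsey_number t t + 4))"
    using solvable_subgraph_complement[OF assms] by blast
  have "(\<lambda>n. poly f (real n) * real n ^ (8 * ramsey_number t t + 4)) \<in>
      O(\<lambda>n. real n ^ (degree f + (8 * ramsey_number t t + 4)))"
    unfolding power_add[of _ "degree f"] by (intro landau_o.big.mult poly_bigo) simp
  then show "solvable_in_polynomial_time (subgraph_complement_to \<G>)"
    unfolding solvable_in_polynomial_time_def using solvable_in_time_mono[OF solvable] by blast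
next
  let ?K = "{G :: nat graph. simple_graph G \<and> complete_free t G}"
  let ?T = "\<lambda>n. 3 * n + 5 + (5 * (n + 1)) ^ t * cost (check_tuple t)"
  have "decides_within (clique_checker t) (\<lambda>G. G \<in> ?K) ?T"
    using decides_clique_checker[of t] unfolding decides_within_def by simp
  moreover have "(\<lambda>n. real (?T n)) \<in> O(\<lambda>n. real n ^ t)"
  proof -
    define C where "C = 8 + 5 ^ t * cost (check_tuple t)"
    have "?T n \<le> C * (n + 1) ^ t" for n
    proof -
      \<comment> \<open>For \<open>t \<ge> 1\<close> the linear overhead of the checker is dominated
        by the enumeration of tuples.\<close>
      have "n + 1 \<le> (n + 1) ^ t" using power_increasing[of 1 t "n + 1"] assms by simp
      then have "3 * n + 5 \<le> 8 * (n + 1) ^ t" by linarith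
      then show ?thesis
        unfolding C_def power_mult_distrib distrib_right by (simp add: ac_simps)
    qed
    then have "real (?T n) \<le> real C * real (n + 1) ^ t" for n
      by (metis of_nat_le_iff of_nat_mult of_nat_power)
    then have "(\<lambda>n. real (?T n)) \<in> O(\<lambda>n. real (n + 1) ^ t)"
      by (intro bigoI[of _ "real C"]) (simp add: abs_mult)
    also have "(\<lambda>n. real (n + 1) ^ t) \<in> O(\<lambda>n. real n ^ t)"
      by (rule suc_power_bigo)
    finally show ?thesis .
  qed
  ultimately have "solvable_in_time (\<lambda>G. G \<in> ?K) (\<lambda>n. real n ^ t)"
    unfolding solvable_in_time_def by blast
  from solvable_subgraph_complement[OF assms _ this]
  have "solvable_in_time (subgraph_complement_to ?K) (\<lambda>n. real n ^ t * real n ^ (8 * ramsey_number t t + 4))"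
    by blast
  then show "solvable_in_time (subgraph_complement_to ?K) (\<lambda>n. real n ^ (8 * ramsey_number t t + t + 4))"
    by (simp add: power_add algebra_simps)
qed

end
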